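(* Let $W$ be a mixing matrix satisfying the assumption on $W$ stated in the context, let $\gamma\in(0,1]$, $\eta>0$, let $\mathcal R$ be a retraction on $\mathcal M$ with associated constant $M_1>0$ (see context), and let $\{x_{i,k}\}$ be generated by $$x_{i,k+1}=\mathcal R_{x_{i,k}}\Big(-\gamma\,\mathcal P_{T_{x_{i,k}}\mathcal M}\Big(x_{i,k}-\sum_{j=1}^n W_{ij}x_{j,k}\Big)+\eta d_{i,k}\Big),\qquad d_{i,k}\in T_{x_{i,k}}\mathcal M,\ i=1,\dots,n,\ k\ge 0.$$ Suppose that $\mathbf x_0\in\mathcal N(\hat\delta)$ with $$\hat\delta\in\Big[0,\ \min\Big\{\frac{8M_1\gamma^2R+1-\sqrt{(8M_1\gamma^2R-1)^2+32M_1\gamma^2R(1-\gamma+\gamma\sigma_2)}}{16M_1\gamma^2},\ \frac R4\Big\}\Big),$$ and that for all $k\ge 0$ $$\|\eta\mathbf d_k\|\le\min\Big\{\frac1{M_1\gamma^2},\ \frac{(1-\rho_2)\hat\delta}{4}\Big\},\qquad\text{where}\quad \rho_2:=\frac{R(1-\gamma+\gamma\sigma_2)}{R-\hat\delta}+8M_1\gamma^2\hat\delta<1 .$$ Then $\mathbf x_k\in\mathcal N(\hat\delta)$ for any $k\ge 0$.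
   Context: $\mathcal M\subset\mathbb R^{d\times r}$ is a compact smooth embedded submanifold with the Euclidean metric, $T_x\mathcal M$ is its tangent space at $x$ and $\mathcal P_{T_x\mathcal M}$ the orthogonal projection onto it; $\|\cdot\|$ is the Euclidean (Frobenius) norm, $\mathrm{dist}(x,\mathcal M)=\inf_{y\in\mathcal M}\|y-x\|$, and $\mathcal P_{\mathcal M}(x)=\arg\min_{y\in\mathcal M}\|y-x\|$ is the nearest-point projection (any nearest point is taken where it is not unique). Throughout, $\mathcal M$ is $R$-proximally smooth for some $R>0$: $\mathcal P_{\mathcal M}(x)$ is a singleton whenever $\mathrm{dist}(x,\mathcal M)<R$. A known consequence is that for every $\tau\in(0,R)$, $\|\mathcal P_{\mathcal M}(x)-\mathcal P_{\mathcal M}(y)\|\le\frac{R}{R-\tau}\|x-y\|$ for all $x,y$ at distance at most $\tau$ from $\mathcal M$. Constant $M_1$: it is known that for any retraction $\mathcal R$ on $\mathcal M$ there is a constant $M_1>0$ such that $\|\mathcal P_{\mathcal M}(x+u)-\mathcal R_x(\mathcal P_{T_x\mathcal M}(u))\|\le M_1\|u\|^2$ for all $x\in\mathcal M$, $u\in\mathbb R^{d\times r}$; $M_1$ denotes such a constant. Assumption on $W\in\mathbb R^{n\times n}$ (the mixing matrix of an undirected network on $n$ agents, with $W_{ij}>0$ if $(i,j)$ is an edge and, for $i\neq j$, $W_{ij}=0$ otherwise): $W$ is doubly stochastic, with $W=W^\top$; $W_{ij}\ge 0$ and $0<W_{ii}<1$ for all $i,j$; the eigenvalues of $W$ lie in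 $(-1,1]$; and the second largest singular value $\sigma_2$ of $W$ lies in $[0,1)$. Notation: for $x_1,\dots,x_n\in\mathcal M$, $\mathbf x=[x_1^\top,\dots,x_n^\top]^\top\in\mathbb R^{nd\times r}$ (an element of $\mathcal M^n$), $\hat x=\frac1n\sum_i x_i$, $\bar x\in\mathcal P_{\mathcal M}(\hat x)$, and $\bar{\mathbf x}=[\bar x^\top,\dots,\bar x^\top]^\top$ ($n$ copies). With iteration index, $\mathbf x_k=[x_{1,k}^\top,\dots,x_{n,k}^\top]^\top$ and $\mathbf d_k=[d_{1,k}^\top,\dots,d_{n,k}^\top]^\top$. The neighborhood is $\mathcal N(\delta)=\{\mathbf x\in\mathcal M^n:\|\mathbf x-\bar{\mathbf x}\|\le\delta\}$. *)

theory Defs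
  imports "HOL-Analysis.Analysis" "HOL-Computational_Algebra.Polynomial"
    "HOL-Library.Multiset"
begin

(* C^k on an open set U of a finite-dimensional space, by recursion on directional
   derivatives: f is C^(k+1) iff it is Frechet differentiable on U and x |-> Df(x) v is C^k
   for every direction v. *)
primrec Ck_on :: "nat \<Rightarrow> 'a::euclidean_space set \<Rightarrow> ('a \<Rightarrow> 'b::euclidean_space) \<Rightarrow> bool" where
  "Ck_on 0 U f \<longleftrightarrow> continuous_on U f"
| "Ck_on (Suc k) U f \<longleftrightarrow>
     (\<forall>x\<in>U. f differentiable (at x)) \<and> (\<forall>v. Ck_on k U (\<lambda>x. frechet_derivative f (at x) v))"

definition smooth_on_open :: "'a::euclidean_space set \<Rightarrow> ('a \<Rightarrow> 'b::euclidean_space) \<Rightarrow> bool" where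
  "smooth_on_open U f \<longleftrightarrow> open U \<and> (\<forall>k. Ck_on k U f)"

(* Smoothness on a subset that need not be open, by local smooth extension. *)
definition smooth_map_on :: "'a::euclidean_space set \<Rightarrow> ('a \<Rightarrow> 'b::euclidean_space) \<Rightarrow> bool" where
  "smooth_map_on S f \<longleftrightarrow>
     (\<forall>p\<in>S. \<exists>U F. p \<in> U \<and> smooth_on_open U F \<and> (\<forall>q\<in>U \<inter> S. F q = f q))"

definition smooth_submanifold :: "nat \<Rightarrow> 'a::euclidean_space set \<Rightarrow> bool" where
  "smooth_submanifold m M \<longleftrightarrow>
     (\<forall>x\<in>M. \<exists>U V \<phi> \<psi>. \<exists>S :: 'a set. x \<in> U \<and> smooth_on_open U \<phi> \<and> smooth_on_open V \<psi> \<and>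
        homeomorphism U V \<phi> \<psi> \<and> subspace S \<and> dim S = m \<and> \<phi> ` (U \<inter> M) = V \<inter> S)"

(* Velocities at 0 of smooth curves in M through x. *)
definition tangent_space :: "'a::euclidean_space set \<Rightarrow> 'a \<Rightarrow> 'a set" where
  "tangent_space M x =
     {v. \<exists>c e. 0 < e \<and> smooth_on_open {-e<..<e} c \<and> c ` {-e<..<e} \<subseteq> M \<and>
           c (0::real) = x \<and> (c has_vector_derivative v) (at 0)}"

definition tangent_bundle :: "'a::euclidean_space set \<Rightarrow> ('a \<times> 'a) set" where
  "tangent_bundle M = Sigma M (tangent_space M)"

definition orth_proj :: "'a::euclidean_space set \<Rightarrow> 'a \<Rightarrow> 'a" where
  "orth_proj T u = (THE p. p \<in> T \<and> (\<forall>t\<in>T. orthogonal (u - p) t))"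

definition nearest_points :: "'a::euclidean_space set \<Rightarrow> 'a \<Rightarrow> 'a set" where
  "nearest_points M x = {y. is_arg_min (\<lambda>y. norm (y - x)) (\<lambda>y. y \<in> M) y}"

(* P is a nearest-point projection onto M, with an arbitrary choice of nearest point
   where it is not unique. *)
definition nearest_point_projection :: "'a::euclidean_space set \<Rightarrow> ('a \<Rightarrow> 'a) \<Rightarrow> bool" where
  "nearest_point_projection M P \<longleftrightarrow> (\<forall>z. P z \<in> nearest_points M z)"

definition proximally_smooth :: "real \<Rightarrow> 'a::euclidean_space set \<Rightarrow> bool" where
  "proximally_smooth R M \<longleftrightarrow> (\<forall>x. infdist x M < R \<longrightarrow> is_singleton (nearest_points M x))"

(* The values of Rt outside the tangent bundle are irrelevant; the derivative of Rt x at 0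
   is therefore taken within the tangent space, where it is the identity. *)
definition retraction_on :: "'a::euclidean_space set \<Rightarrow> ('a \<Rightarrow> 'a \<Rightarrow> 'a) \<Rightarrow> bool" where
  "retraction_on M Rt \<longleftrightarrow>
     (\<forall>(x, v)\<in>tangent_bundle M. Rt x v \<in> M) \<and>
     smooth_map_on (tangent_bundle M) (\<lambda>(x, v). Rt x v) \<and>
     (\<forall>x\<in>M. Rt x 0 = x \<and> (Rt x has_derivative (\<lambda>v. v)) (at 0 within tangent_space M x))"

definition retraction_bound ::
  "'a::euclidean_space set \<Rightarrow> ('a \<Rightarrow> 'a) \<Rightarrow> ('a \<Rightarrow> 'a \<Rightarrow> 'a) \<Rightarrow> real \<Rightarrow> bool" where
  "retraction_bound M P Rt M1 \<longleftrightarrow> 0 < M1 \<and>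
     (\<forall>x\<in>M. \<forall>u. norm (P (x + u) - Rt x (orth_proj (tangent_space M x) u)) \<le> M1 * (norm u)\<^sup>2)"

definition char_poly :: "real ^ 'n ^ 'n \<Rightarrow> real poly" where
  "char_poly A = det (\<chi> i j. (if i = j then [:0, 1:] else 0) - [:A $ i $ j:])"

(* Real eigenvalues, counted with algebraic multiplicity. For the symmetric matrices to which
   this is applied, these are all the eigenvalues. *)
definition eigenvalues :: "real ^ 'n ^ 'n \<Rightarrow> real multiset" where
  "eigenvalues A = proots (char_poly A)"

definition singular_values :: "real ^ 'n ^ 'n \<Rightarrow> real multiset" where
  "singular_values A = image_mset sqrt (eigenvalues (transpose A ** A))"

(* Second in decreasing order, repetitions included; only meaningful for n >= 2. *)
definition second_singular_value :: "real ^ 'n ^ 'n \<Rightarrow> real" where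
  "second_singular_value A = rev (sorted_list_of_multiset (singular_values A)) ! 1"

definition doubly_stochastic :: "real ^ 'n ^ 'n \<Rightarrow> bool" where
  "doubly_stochastic W \<longleftrightarrow> (\<forall>i j. 0 \<le> W $ i $ j) \<and>
     (\<forall>i. (\<Sum>j\<in>UNIV. W $ i $ j) = 1) \<and> (\<forall>j. (\<Sum>i\<in>UNIV. W $ i $ j) = 1)"

(* E is the edge relation of the undirected network. The bounds 0 < W_ii < 1 force n >= 2. *)
definition mixing_matrix :: "('n \<times> 'n) set \<Rightarrow> real ^ 'n ^ 'n \<Rightarrow> bool" where
  "mixing_matrix E W \<longleftrightarrow>
     sym E \<and> (\<forall>(i, j)\<in>E. 0 < W $ i $ j) \<and>
     (\<forall>i j. i \<noteq> j \<and> (i, j) \<notin> E \<longrightarrow> W $ i $ j = 0) \<and>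
     doubly_stochastic W \<and> transpose W = W \<and>
     (\<forall>i. 0 < W $ i $ i \<and> W $ i $ i < 1) \<and>
     (\<forall>c\<in>#eigenvalues W. -1 < c \<and> c \<le> 1) \<and>
     0 \<le> second_singular_value W \<and> second_singular_value W < 1"

(* The stacked variable [x_1^T, ..., x_n^T]^T is an element of 'a ^ 'n, whose norm
   is the Frobenius norm of the stacked matrix. *)
definition agent_mean :: "'a::euclidean_space ^ 'n \<Rightarrow> 'a" where
  "agent_mean X = (1 / real CARD('n)) *\<^sub>R (\<Sum>i\<in>UNIV. X $ i)"

definition consensus_nbhd ::
  "'a::euclidean_space set \<Rightarrow> ('a \<Rightarrow> 'a) \<Rightarrow> real \<Rightarrow> ('a ^ 'n) set" where
  "consensus_nbhd M P \<delta> =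
     {X. (\<forall>i. X $ i \<in> M) \<and> norm (X - (\<chi> i. P (agent_mean X))) \<le> \<delta>}"

end

theory Submission
  imports Defs
begin

text \<open>
  Write \<open>m\<close> for the mean of the iterates \<open>x\<^sub>i\<close> and \<open>p = P m\<close> for its projection. By Pythagoras,
  \<open>\<Sum> \<parallel>x\<^sub>i - y\<parallel>\<^sup>2\<close> is, up to a constant, a multiple of \<open>\<parallel>m - y\<parallel>\<^sup>2\<close>, so \<open>p\<close> minimises it over
  \<open>y \<in> M\<close>. Hence the distance of the next iterate to its own projected mean is at most its
  distance to the old \<open>p\<close> (\<open>projected_mean_optimal\<close>), and it suffices to bound the latter by \<open>\<delta>\<close>,
  by induction over the steps.

  Since tangent spaces are subspaces, the argument of the retraction is the tangential part of
  \<open>u\<^sub>i = b\<^sub>i - x\<^sub>i + \<eta> d\<^sub>i\<close>, where \<open>b\<^sub>i = (1 - \<gamma>) x\<^sub>i + \<gamma> \<Sum>\<^sub>j W\<^sub>i\<^sub>j x\<^sub>j\<close>. So the next iterate differs from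
  \<open>P (b\<^sub>i + \<eta> d\<^sub>i)\<close> by at most \<open>M1 \<parallel>u\<^sub>i\<parallel>\<^sup>2\<close>. That point differs from \<open>P b\<^sub>i\<close> by at most
  \<open>16 / 11 \<parallel>\<eta> d\<^sub>i\<parallel>\<close>, and \<open>P b\<^sub>i\<close> differs from \<open>p = P m\<close> by at most \<open>R / (R - \<delta>) \<parallel>b\<^sub>i - m\<parallel>\<close>.
  Averaging contracts the deviation from the mean by the factor \<open>1 - \<gamma> + \<gamma> \<sigma>2\<close>. The quadratic
  terms sum to at most \<open>8 M1 \<gamma>\<^sup>2 \<delta>\<^sup>2 + 2 M1 \<parallel>\<eta> d\<parallel>\<^sup>2\<close>. All in all one gets \<open>\<rho>2 \<delta>\<close> plus an error from the
  perturbation of at most \<open>4 \<parallel>\<eta> d\<parallel> \<le> (1 - \<rho>2) \<delta>\<close>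
  (\<open>consensus_error_budget\<close>, \<open>consensus_nbhd_step\<close>).

  Two ingredients need an argument of their own.

  The Lipschitz estimate \<open>projection_lipschitz\<close> for the metric projection onto a proximally smooth
  set. Uniqueness of nearest points up to distance \<open>R\<close> must be turned into balls of every radius
  below \<open>R\<close> that touch \<open>M\<close> from outside. This is a consequence of Brouwer's fixed point theorem
  (\<open>projection_along_normal_ray\<close>), and two touching balls give the estimate by adding inner
  products.

  The contraction \<open>second_singular_value_bound\<close>. The singular values are defined through roots of a
  characteristic polynomial, counted with multiplicity, whereas the contraction is a variational
  property of \<open>W\<^sup>T W\<close> on the vectors of mean zero. A maximiser of \<open>\<parallel>W v\<parallel> / \<parallel>v\<parallel>\<close> on these vectors
  is an eigenvector of \<open>W\<^sup>T W\<close> orthogonal to the all-ones eigenvector. If both belong to the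
  eigenvalue \<open>1\<close>, it must be seen to be a double root, which Cramer's rule shows.
\<close>

section \<open>Metric projection onto a proximally smooth set\<close>

lemma nearest_points_iff:
  "y \<in> nearest_points M x \<longleftrightarrow> y \<in> M \<and> (\<forall>z\<in>M. norm (y - x) \<le> norm (z - x))"
  by (auto simp: nearest_points_def is_arg_min_def not_less)

lemma nearest_point_projection_in:
  assumes "nearest_point_projection M P"
  shows "P z \<in> M"
  using assms by (auto simp: nearest_point_projection_def nearest_points_iff)

lemma nearest_point_projection_le:
  assumes "nearest_point_projection M P" "y \<in> M"
  shows "norm (P z - z) \<le> norm (y - z)"
  using assms by (auto simp: nearest_point_projection_def nearest_points_iff)

lemma infdist_eq_norm_projection:
  fixes M :: "'a::euclidean_space set"
  assumes "nearest_point_projection M P"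
  shows "infdist z M = norm (P z - z)"
proof (rule antisym)
  show "infdist z M \<le> norm (P z - z)"
    using infdist_le[OF nearest_point_projection_in[OF assms], of z z]
    by (simp add: dist_norm norm_minus_commute)
  have "M \<noteq> {}"
    using nearest_point_projection_in[OF assms] by auto
  then show "norm (P z - z) \<le> infdist z M"
    unfolding infdist_notempty[OF \<open>M \<noteq> {}\<close>]
    using nearest_point_projection_le[OF assms, of _ z]
    by (intro cINF_greatest) (auto simp: dist_norm norm_minus_commute)
qed

lemma nearest_point_eq_projection:
  fixes M :: "'a::euclidean_space set"
  assumes "proximally_smooth R M" "nearest_point_projection M P"
    and "y \<in> nearest_points M z" "norm (y - z) < R"
  shows "y = P z"
proof -
  have "infdist z M < R"
    using nearest_point_projection_le[OF assms(2), of y z] assms(3,4)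
      infdist_eq_norm_projection[OF assms(2), of z] by (simp add: nearest_points_iff)
  then have "is_singleton (nearest_points M z)"
    using assms(1) by (auto simp: proximally_smooth_def)
  then show ?thesis
    using assms(2,3) unfolding nearest_point_projection_def is_singleton_def by fastforce
qed

text \<open>Being a nearest point is a closed condition on pairs, and a closed graph with values in a
  compact set is the graph of a continuous function.\<close>

lemma continuous_on_projection:
  fixes M :: "'a::euclidean_space set"
  assumes "compact M" "proximally_smooth R M" "nearest_point_projection M P"
  shows "continuous_on {z. infdist z M < R} P"
proof -
  let ?S = "{z. infdist z M < R}"
  have "(\<lambda>z. Pair z (P z)) ` ?S = (?S \<times> M) \<inter> {w. norm (snd w - fst w) \<le> infdist (fst w) M}"
  proof (intro equalityI subsetI)
    fix w assume "w \<in> (?S \<times> M) \<inter> {w. norm (snd w - fst w) \<le> infdist (fst w) M}"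
    then have w: "infdist (fst w) M < R" "snd w \<in> M" "norm (snd w - fst w) \<le> infdist (fst w) M"
      by auto
    have "snd w \<in> nearest_points M (fst w)"
      unfolding nearest_points_iff
      using w nearest_point_projection_le[OF assms(3), of _ "fst w"]
      by (auto simp: infdist_eq_norm_projection[OF assms(3)] intro: order_trans)
    then have "snd w = P (fst w)"
      using nearest_point_eq_projection[OF assms(2,3)] w by auto
    then show "w \<in> (\<lambda>z. Pair z (P z)) ` ?S"
      using w by (intro image_eqI[of _ _ "fst w"]) (auto intro: prod_eqI)
  qed (auto simp: infdist_eq_norm_projection[OF assms(3)] nearest_point_projection_in[OF assms(3)])
  moreover have "closed {w :: 'a \<times> 'a. norm (snd w - fst w) \<le> infdist (fst w) M}"
    by (intro closed_Collect_le continuous_intros)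
  ultimately have "closedin (top_of_set (?S \<times> M)) ((\<lambda>z. Pair z (P z)) ` ?S)"
    by (simp add: closedin_closed_Int)
  then show ?thesis
    using continuous_closed_graph_eq[OF assms(1), of P ?S]
      nearest_point_projection_in[OF assms(3)] by auto
qed

text \<open>The norm equation places \<open>z\<close> on the segment from \<open>w\<close> to \<open>P w\<close>. By the triangle inequality, a
  point of \<open>M\<close> closer to \<open>z\<close> than \<open>P w\<close> would also be closer to \<open>w\<close> than \<open>P w\<close>.\<close>

lemma projection_along_segment:
  fixes M :: "'a::euclidean_space set"
  assumes "proximally_smooth R M" "nearest_point_projection M P"
    and "norm (P w - w) = norm (P w - z) + norm (z - w)" "norm (P w - z) < R"
  shows "P z = P w"
proof -
  have "norm (P w - z) \<le> norm (y - z)" if "y \<in> M" for y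
  proof -
    have "norm (P w - w) \<le> norm (y - w)"
      by (rule nearest_point_projection_le[OF assms(2) that])
    also have "\<dots> \<le> norm (y - z) + norm (z - w)"
      using dist_triangle[of y w z] by (simp add: dist_norm)
    finally show ?thesis
      using assms(3) by simp
  qed
  then have "P w \<in> nearest_points M z"
    using nearest_point_projection_in[OF assms(2)] by (simp add: nearest_points_iff)
  then show ?thesis
    using nearest_point_eq_projection[OF assms(1,2) _ assms(4)] by simp
qed

text \<open>Moving away from the nearest point along the normal ray does not change the nearest point as
  long as the distance stays below \<open>R\<close>. The map sending \<open>w\<close> in the \<open>\<epsilon>\<close>-ball around \<open>z\<close> to the point
  of its boundary opposite to \<open>P w\<close> is continuous, so Brouwer's theorem gives a fixed point \<open>w\<close>. Then \<open>z\<close>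
  lies between \<open>P w\<close> and \<open>w\<close>, whence \<open>P w = P z\<close>, and this forces \<open>w\<close> to lie on the ray.\<close>

lemma projection_along_normal_ray:
  fixes M :: "'a::euclidean_space set"
  assumes "compact M" "proximally_smooth R M" "nearest_point_projection M P"
    and "z \<notin> M" "0 < \<epsilon>" "norm (z - P z) + \<epsilon> < R"
  shows "P (z + \<epsilon> *\<^sub>R sgn (z - P z)) = P z"
proof -
  have tube: "cball z \<epsilon> \<subseteq> {w. infdist w M < R}"
  proof
    fix w assume "w \<in> cball z \<epsilon>"
    then have "norm (z - w) \<le> \<epsilon>"
      by (simp add: dist_norm)
    have "infdist w M \<le> norm (P z - w)"
      using infdist_le[OF nearest_point_projection_in[OF assms(3)], of w z]
      by (simp add: dist_norm norm_minus_commute)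
    also have "\<dots> \<le> norm (P z - z) + norm (z - w)"
      using dist_triangle[of "P z" w z] by (simp add: dist_norm)
    finally show "w \<in> {w. infdist w M < R}"
      using assms(6) \<open>norm (z - w) \<le> \<epsilon>\<close> by (simp add: norm_minus_commute)
  qed
  have ne: "z - P w \<noteq> 0" for w
    using assms(4) nearest_point_projection_in[OF assms(3), of w] by auto
  define f where "f = (\<lambda>w. z + \<epsilon> *\<^sub>R sgn (z - P w))"
  have "continuous_on (cball z \<epsilon>) P"
    using continuous_on_projection[OF assms(1-3)] tube continuous_on_subset by blast
  then have "continuous_on (cball z \<epsilon>) f"
    unfolding f_def using ne by (intro continuous_intros) auto
  moreover have "f \<in> cball z \<epsilon> \<rightarrow> cball z \<epsilon>"
    using assms(5) by (auto simp: f_def dist_norm norm_sgn)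
  ultimately obtain w where w: "w \<in> cball z \<epsilon>" "f w = w"
    using brouwer[of "cball z \<epsilon>" f] assms(5) by auto
  define c where "c = norm (z - P w)"
  have c: "0 < c" "c *\<^sub>R sgn (z - P w) = z - P w"
    using ne[of w] by (auto simp: c_def sgn_div_norm)
  have wz: "w - z = \<epsilon> *\<^sub>R sgn (z - P w)"
    using w(2) by (simp add: f_def algebra_simps)
  have "w - P w = (c + \<epsilon>) *\<^sub>R sgn (z - P w)"
    unfolding scaleR_add_left c(2) wz[symmetric] by simp
  then have "norm (w - P w) = c + \<epsilon>"
    using c(1) assms(5) ne[of w] by (simp add: norm_sgn)
  moreover have "norm (w - z) = \<epsilon>"
    using assms(5) ne[of w] by (simp add: wz norm_sgn)
  ultimately have len: "norm (P w - w) = norm (P w - z) + norm (z - w)"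
    by (simp add: c_def norm_minus_commute)
  have "norm (P w - w) < R"
    using tube w(1) infdist_eq_norm_projection[OF assms(3), of w] by auto
  then have "P z = P w"
    using projection_along_segment[OF assms(2,3) len] len norm_ge_zero[of "z - w"] by linarith
  then show ?thesis
    using w(2) by (simp add: f_def)
qed

text \<open>By the previous lemma, every ball of radius below \<open>R\<close> that touches \<open>M\<close> at \<open>P z\<close> from the
  side of \<open>z\<close> has no point of \<open>M\<close> in its interior; expand the squared distance to its centre and
  let the radius grow to \<open>R\<close>.\<close>

lemma proximal_normal_inequality:
  fixes M :: "'a::euclidean_space set"
  assumes "compact M" "proximally_smooth R M" "nearest_point_projection M P"
    and "norm (z - P z) < R" "q \<in> M"
  shows "2 * R * ((z - P z) \<bullet> (q - P z)) \<le> norm (z - P z) * (norm (q - P z))\<^sup>2"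
proof (cases "z \<in> M")
  case True
  then have "norm (P z - z) = 0"
    using nearest_point_projection_le[OF assms(3) True, of z] by simp
  then show ?thesis by simp
next
  case False
  define s where "s = norm (z - P z)"
  have "0 < s"
    unfolding s_def using False nearest_point_projection_in[OF assms(3), of z] by auto
  define u where "u = sgn (z - P z)"
  have u: "norm u = 1" "z - P z = s *\<^sub>R u"
    using \<open>0 < s\<close> by (auto simp: s_def u_def norm_sgn sgn_div_norm)
  have touching: "2 * t * (u \<bullet> (q - P z)) \<le> (norm (q - P z))\<^sup>2" if t: "s < t" "t < R" for t
  proof -
    let ?c = "z + (t - s) *\<^sub>R u"
    have "P ?c = P z"
      using projection_along_normal_ray[OF assms(1-3) False, of "t - s"] t
      by (simp add: s_def u_def)
    then have "norm (P z - ?c) \<le> norm (q - ?c)"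
      using nearest_point_projection_le[OF assms(3,5), of ?c] by simp
    moreover have "P z - ?c = - (t *\<^sub>R u)" "q - ?c = (q - P z) - t *\<^sub>R u"
      using u(2) by (auto simp: algebra_simps)
    ultimately have "norm (t *\<^sub>R u) \<le> norm ((q - P z) - t *\<^sub>R u)"
      by simp
    then have "(norm (t *\<^sub>R u))\<^sup>2 \<le> (norm ((q - P z) - t *\<^sub>R u))\<^sup>2"
      by (rule power_mono) simp
    moreover have "(norm (p - t *\<^sub>R u))\<^sup>2 = (norm p)\<^sup>2 - 2 * t * (u \<bullet> p) + (norm (t *\<^sub>R u))\<^sup>2" for p
      unfolding power2_norm_eq_inner by (simp add: inner_diff inner_commute)
    ultimately show ?thesis
      by simp
  qed
  have "2 * R * (u \<bullet> (q - P z)) \<le> (norm (q - P z))\<^sup>2"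
  proof (rule tendsto_le[OF trivial_limit_at_left_real])
    show "((\<lambda>t. 2 * t * (u \<bullet> (q - P z))) \<longlongrightarrow> 2 * R * (u \<bullet> (q - P z))) (at_left R)"
      by (intro tendsto_intros)
    show "eventually (\<lambda>t. 2 * t * (u \<bullet> (q - P z)) \<le> (norm (q - P z))\<^sup>2) (at_left R)"
      using eventually_at_left_real[of s R] assms(4) touching
      by (auto simp: s_def elim!: eventually_mono)
  qed (rule tendsto_const)
  then have "s * (2 * R * (u \<bullet> (q - P z))) \<le> s * (norm (q - P z))\<^sup>2"
    using \<open>0 < s\<close> by simp
  moreover have "(z - P z) \<bullet> (q - P z) = s * (u \<bullet> (q - P z))"
    by (metis u(2) inner_scaleR_left)
  ultimately show ?thesis
    unfolding s_def[symmetric] by (simp add: mult_ac)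
qed

text \<open>Add the inequalities of the previous lemma for the two normals \<open>y - P y\<close> and \<open>z - P z\<close>,
  each tested against the foot point of the other.\<close>

lemma projection_lipschitz:
  fixes M :: "'a::euclidean_space set"
  assumes "compact M" "proximally_smooth R M" "nearest_point_projection M P"
    and "\<tau> < R" "norm (y - P y) \<le> \<tau>" "norm (z - P z) \<le> \<tau>"
  shows "norm (P y - P z) \<le> R / (R - \<tau>) * norm (y - z)"
proof -
  have "0 \<le> \<tau>"
    using assms(5) norm_ge_zero order_trans by blast
  define w where "w = P y - P z"
  have cross: "2 * R * ((v - P v) \<bullet> (P v' - P v)) \<le> \<tau> * (norm (P v' - P v))\<^sup>2"
    if "norm (v - P v) \<le> \<tau>" for v v'
    by (rule order_trans[OF proximal_normal_inequality[OF assms(1-3)] mult_right_mono])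
      (use that assms(4) nearest_point_projection_in[OF assms(3)] in auto)
  have "2 * R * ((y - P y) \<bullet> (P z - P y)) \<le> \<tau> * (norm w)\<^sup>2"
    using cross[OF assms(5), of z] by (simp add: w_def norm_minus_commute)
  moreover have "2 * R * ((z - P z) \<bullet> (P y - P z)) \<le> \<tau> * (norm w)\<^sup>2"
    using cross[OF assms(6), of y] by (simp add: w_def)
  ultimately have "R * ((y - P y) \<bullet> (P z - P y)) + R * ((z - P z) \<bullet> (P y - P z)) \<le> \<tau> * (norm w)\<^sup>2"
    by linarith
  moreover have "R * ((y - P y) \<bullet> (P z - P y)) + R * ((z - P z) \<bullet> (P y - P z))
      = R * (norm w)\<^sup>2 - R * ((y - z) \<bullet> w)"
    by (simp add: w_def power2_norm_eq_inner inner_diff inner_commute algebra_simps)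
  ultimately have "(R - \<tau>) * (norm w)\<^sup>2 \<le> R * ((y - z) \<bullet> w)"
    by (simp add: algebra_simps)
  also have "\<dots> \<le> R * (norm (y - z) * norm w)"
    using assms(4) \<open>0 \<le> \<tau>\<close> by (intro mult_left_mono norm_cauchy_schwarz) auto
  finally have "((R - \<tau>) * norm w) * norm w \<le> (R * norm (y - z)) * norm w"
    by (simp add: power2_eq_square mult.assoc)
  then have "(R - \<tau>) * norm w \<le> R * norm (y - z)"
    using assms(4) \<open>0 \<le> \<tau>\<close> by (cases "w = 0") auto
  then show ?thesis
    using assms(4) by (simp add: w_def field_simps)
qed

section \<open>Tangent spaces are subspaces\<close>

lemma Ck_on_cong:
  assumes "open U" "\<And>x. x \<in> U \<Longrightarrow> f x = g x" "Ck_on k U f"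
  shows "Ck_on k U g"
  using assms(2,3)
proof (induction k arbitrary: f g)
  case 0
  then show ?case
    by (auto cong: continuous_on_cong)
next
  case (Suc k)
  have diff: "f differentiable (at x)" if "x \<in> U" for x
    using Suc.prems(2) that by simp
  have "g differentiable (at x)" if "x \<in> U" for x
    using has_derivative_transform_within_open[OF _ assms(1) that Suc.prems(1),
        OF diff[OF that, unfolded frechet_derivative_works]]
    by (auto simp: differentiable_def)
  moreover have "Ck_on k U (\<lambda>x. frechet_derivative g (at x) v)" for v
  proof (rule Suc.IH)
    show "Ck_on k U (\<lambda>x. frechet_derivative f (at x) v)"
      using Suc.prems(2) by simp
    show "frechet_derivative f (at x) v = frechet_derivative g (at x) v" if "x \<in> U" for x
      by (subst frechet_derivative_transform_within_open[OF diff[OF that] assms(1) that])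
        (auto intro: Suc.prems(1))
  qed
  ultimately show ?case by simp
qed

text \<open>Differentiating along the line multiplies by a scalar and replaces \<open>F\<close> by a directional
  derivative of \<open>F\<close>; the factor \<open>s\<close> makes this form stable under differentiation.\<close>

lemma Ck_on_along_line:
  fixes F :: "'a::euclidean_space \<Rightarrow> 'b::euclidean_space" and s :: real
  assumes "open I" "\<And>t. t \<in> I \<Longrightarrow> a + t *\<^sub>R w \<in> V" "Ck_on k V F"
  shows "Ck_on k I (\<lambda>t::real. s *\<^sub>R F (a + t *\<^sub>R w))"
  using assms(3)
proof (induction k arbitrary: F s)
  case 0
  have "continuous_on I (\<lambda>t. F (a + t *\<^sub>R w))"
    using 0 assms(2)
    by (intro continuous_on_compose2[of V F I "\<lambda>t. a + t *\<^sub>R w"] continuous_intros) auto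
  then show ?case
    by (auto intro: continuous_intros)
next
  case (Suc k)
  define F' where "F' = (\<lambda>x. frechet_derivative F (at x))"
  have der: "((\<lambda>t. s *\<^sub>R F (a + t *\<^sub>R w)) has_derivative
      (\<lambda>h. (s * h) *\<^sub>R F' (a + t *\<^sub>R w) w)) (at t)" if "t \<in> I" for t
  proof -
    have F: "(F has_derivative F' (a + t *\<^sub>R w)) (at (a + t *\<^sub>R w))"
      using Suc.prems assms(2)[OF that] by (simp add: F'_def frechet_derivative_works)
    have "((\<lambda>t. s *\<^sub>R F (a + t *\<^sub>R w)) has_derivative
        (\<lambda>h. s *\<^sub>R F' (a + t *\<^sub>R w) (h *\<^sub>R w))) (at t)"
      by (rule has_derivative_scaleR_right,
          rule has_derivative_compose[where g = F and f = "\<lambda>t. a + t *\<^sub>R w" and x = t, OF _ F])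
        (auto intro!: derivative_eq_intros)
    then show ?thesis
      by (simp add: linear_cmul[OF has_derivative_linear[OF F]])
  qed
  have "Ck_on k I (\<lambda>t. (s * h) *\<^sub>R F' (a + t *\<^sub>R w) w)" for h
    using Suc.IH[of "\<lambda>x. F' x w" "s * h"] Suc.prems by (simp add: F'_def)
  then have "Ck_on k I (\<lambda>t. frechet_derivative (\<lambda>t. s *\<^sub>R F (a + t *\<^sub>R w)) (at t) h)" for h
  proof (rule Ck_on_cong[OF assms(1), rotated])
    show "(s * h) *\<^sub>R F' (a + t *\<^sub>R w) w
        = frechet_derivative (\<lambda>t. s *\<^sub>R F (a + t *\<^sub>R w)) (at t) h" if "t \<in> I" for t
      by (subst frechet_derivative_at[OF der[OF that], symmetric]) (rule refl)
  qed
  moreover have "(\<lambda>t. s *\<^sub>R F (a + t *\<^sub>R w)) differentiable (at t)" if "t \<in> I" for t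
    using der[OF that] by (auto simp: differentiable_def)
  ultimately show ?case by simp
qed

lemma smooth_on_open_has_derivative:
  assumes "smooth_on_open U f" "x \<in> U"
  shows "(f has_derivative frechet_derivative f (at x)) (at x)"
proof -
  have "Ck_on (Suc 0) U f"
    using assms(1) by (simp only: smooth_on_open_def)
  then show ?thesis
    using assms(2) by (simp add: frechet_derivative_works)
qed

text \<open>In a flattening chart a curve in \<open>M\<close> becomes a curve in the closed subspace \<open>S\<close>, so its
  velocity stays in \<open>S\<close>; conversely a direction in \<open>S\<close> is the velocity of a straight line, which
  the inverse chart maps to a smooth curve in \<open>M\<close>.\<close>

lemma tangent_space_eq_chart:
  fixes M :: "'a::euclidean_space set"
  assumes "x \<in> M" "x \<in> U" "smooth_on_open U \<phi>" "smooth_on_open V \<psi>" "homeomorphism U V \<phi> \<psi>"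
    and "subspace (S :: 'a set)" "\<phi> ` (U \<inter> M) = V \<inter> S"
  shows "tangent_space M x = {v. frechet_derivative \<phi> (at x) v \<in> S}"
proof (intro equalityI subsetI)
  define D where "D = frechet_derivative \<phi> (at x)"
  have D: "(\<phi> has_derivative D) (at x)"
    unfolding D_def by (rule smooth_on_open_has_derivative[OF assms(3,2)])
  fix v assume "v \<in> tangent_space M x"
  then obtain c and e :: real where c: "0 < e" "c ` {-e<..<e} \<subseteq> M" "c 0 = x"
      "(c has_vector_derivative v) (at 0)"
    unfolding tangent_space_def by blast
  have "open U"
    using assms(3) by (simp add: smooth_on_open_def)
  have "((\<lambda>t. \<phi> (c t)) has_derivative (\<lambda>t. D (t *\<^sub>R v))) (at 0)"
    using has_derivative_compose[of c "\<lambda>t. t *\<^sub>R v" 0 UNIV \<phi> D] c(3,4) D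
    by (simp add: has_vector_derivative_def)
  then have "((\<lambda>t. \<phi> (c t)) has_derivative (\<lambda>t. t *\<^sub>R D v)) (at 0)"
    by (simp add: linear_cmul[OF has_derivative_linear[OF D]])
  then have "((\<lambda>t. norm ((\<phi> (c t) - \<phi> x - t *\<^sub>R D v) /\<^sub>R t)) \<longlongrightarrow> 0) (at 0)"
    using c(3) by (simp add: has_derivative_iff_norm divide_inverse mult.commute)
  then have "((\<lambda>t. (\<phi> (c t) - \<phi> x - t *\<^sub>R D v) /\<^sub>R t + D v) \<longlongrightarrow> 0 + D v) (at 0)"
    by (intro tendsto_add tendsto_const) (rule tendsto_norm_zero_cancel)
  moreover have "eventually (\<lambda>t. (\<phi> (c t) - \<phi> x - t *\<^sub>R D v) /\<^sub>R t + D v = (\<phi> (c t) - \<phi> x) /\<^sub>R t) (at 0)"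
    by (auto simp: eventually_at_filter scaleR_diff_right)
  ultimately have "((\<lambda>t. (\<phi> (c t) - \<phi> x) /\<^sub>R t) \<longlongrightarrow> D v) (at 0)"
    using Lim_transform_eventually by fastforce
  moreover have "eventually (\<lambda>t. (\<phi> (c t) - \<phi> x) /\<^sub>R t \<in> S) (at 0)"
  proof -
    have "isCont c 0"
      using c(4) by (rule has_vector_derivative_continuous)
    then have "eventually (\<lambda>t. c t \<in> U) (at 0)"
      using \<open>open U\<close> assms(2) c(3) topological_tendstoD[of c "c 0" "at 0" U] by (simp add: isCont_def)
    moreover have "eventually (\<lambda>t. t \<in> {-e<..<e}) (at 0)"
      using c(1) by (intro eventually_at_in_open') auto
    ultimately show ?thesis
    proof eventually_elim
      case (elim t)
      then have "\<phi> (c t) \<in> S"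
        using c(2) assms(7) by blast
      moreover have "\<phi> x \<in> S"
        using assms(1,2,7) by blast
      ultimately show ?case
        using assms(6) by (simp add: subspace_diff subspace_scale)
    qed
  qed
  ultimately have "D v \<in> S"
    by (intro Lim_in_closed_set[OF closed_subspace[OF assms(6)]]) auto
  then show "v \<in> {v. frechet_derivative \<phi> (at x) v \<in> S}"
    by (simp add: D_def)
next
  define D where "D = frechet_derivative \<phi> (at x)"
  have D: "(\<phi> has_derivative D) (at x)"
    unfolding D_def by (rule smooth_on_open_has_derivative[OF assms(3,2)])
  fix v assume "v \<in> {v. frechet_derivative \<phi> (at x) v \<in> S}"
  then have "D v \<in> S" by (simp add: D_def)
  have inv: "\<And>y. y \<in> U \<Longrightarrow> \<psi> (\<phi> y) = y" "\<phi> ` U = V"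
    using assms(5) by (auto simp: homeomorphism_def)
  have "\<phi> x \<in> V"
    using inv(2) assms(2) by blast
  have "open U" "open V"
    using assms(3,4) by (auto simp: smooth_on_open_def)
  define I where "I = (\<lambda>t. \<phi> x + t *\<^sub>R D v) -` V"
  have "open I"
    unfolding I_def by (intro open_vimage \<open>open V\<close> continuous_intros)
  moreover have "0 \<in> I"
    using \<open>\<phi> x \<in> V\<close> by (simp add: I_def)
  ultimately obtain e where e: "0 < e" "ball 0 e \<subseteq> I"
    using openE by blast
  then have sub: "{-e<..<e} \<subseteq> I"
    by (auto simp: subset_iff dist_real_def)
  define c where "c = (\<lambda>t. \<psi> (\<phi> x + t *\<^sub>R D v))"
  have "Ck_on k {-e<..<e} c" for k
    using Ck_on_along_line[of "{-e<..<e}" "\<phi> x" "D v" V k \<psi> 1] subsetD[OF sub] assms(4)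
    by (simp add: c_def I_def smooth_on_open_def)
  then have "smooth_on_open {-e<..<e} c"
    by (simp add: smooth_on_open_def)
  moreover have "c ` {-e<..<e} \<subseteq> M"
  proof clarify
    fix t assume "t \<in> {-e<..<e}"
    then have "\<phi> x + t *\<^sub>R D v \<in> V"
      using sub by (auto simp: I_def)
    moreover have "\<phi> x \<in> S"
      using assms(1,2,7) by blast
    then have "\<phi> x + t *\<^sub>R D v \<in> S"
      using assms(6) \<open>D v \<in> S\<close> by (simp add: subspace_add subspace_scale)
    ultimately obtain y where "y \<in> U \<inter> M" "\<phi> x + t *\<^sub>R D v = \<phi> y"
      using assms(7) by blast
    then show "c t \<in> M"
      using inv(1) by (simp add: c_def)
  qed
  moreover have "c 0 = x"
    using inv(1) assms(2) by (simp add: c_def)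
  moreover have "(c has_vector_derivative v) (at 0)"
  proof -
    define D' where "D' = frechet_derivative \<psi> (at (\<phi> x))"
    have D': "(\<psi> has_derivative D') (at (\<phi> x))"
      unfolding D'_def by (rule smooth_on_open_has_derivative[OF assms(4) \<open>\<phi> x \<in> V\<close>])
    have "((\<lambda>y. \<psi> (\<phi> y)) has_derivative (\<lambda>h. D' (D h))) (at x)"
      by (rule has_derivative_compose[OF D D'])
    then have "((\<lambda>y. y) has_derivative (\<lambda>h. D' (D h))) (at x)"
      by (rule has_derivative_transform_within_open[OF _ \<open>open U\<close> assms(2)]) (rule inv(1))
    then have "(\<lambda>h. D' (D h)) = (\<lambda>h. h)"
      by (rule has_derivative_unique) (rule has_derivative_ident)
    then have "D' (D v) = v"
      by (rule fun_cong)
    moreover have "((\<lambda>t. \<phi> x + t *\<^sub>R D v) has_derivative (\<lambda>t. t *\<^sub>R D v)) (at 0)"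
      by (auto intro!: derivative_eq_intros)
    then have "(c has_derivative (\<lambda>t. D' (t *\<^sub>R D v))) (at 0)"
      unfolding c_def using D'
      by (intro has_derivative_compose[where f = "\<lambda>t. \<phi> x + t *\<^sub>R D v" and g = \<psi>]) simp_all
    ultimately show ?thesis
      by (simp add: has_vector_derivative_def linear_cmul[OF has_derivative_linear[OF D']])
  qed
  ultimately show "v \<in> tangent_space M x"
    using e(1) by (auto simp: tangent_space_def)
qed

lemma subspace_tangent_space:
  assumes "smooth_submanifold m M" "x \<in> M"
  shows "subspace (tangent_space M x)"
proof -
  obtain U V \<phi> \<psi> and S :: "'a set" where chart: "x \<in> U" "smooth_on_open U \<phi>" "smooth_on_open V \<psi>"
      "homeomorphism U V \<phi> \<psi>" "subspace S" "\<phi> ` (U \<inter> M) = V \<inter> S"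
    using assms unfolding smooth_submanifold_def by meson
  have "linear (frechet_derivative \<phi> (at x))"
    using smooth_on_open_has_derivative[OF chart(2,1)] has_derivative_linear by blast
  then have "subspace (frechet_derivative \<phi> (at x) -` S)"
    using chart(5) by (rule linear_subspace_vimage)
  then show ?thesis
    using tangent_space_eq_chart[OF assms(2) chart] by (simp add: vimage_def)
qed

lemma orth_proj_eqI:
  assumes "subspace T" "p \<in> T" "\<And>t. t \<in> T \<Longrightarrow> orthogonal (u - p) t"
  shows "orth_proj T u = p"
  unfolding orth_proj_def
proof (rule the_equality)
  fix q assume q: "q \<in> T \<and> (\<forall>t\<in>T. orthogonal (u - q) t)"
  have "p - q \<in> T"
    using assms q by (simp add: subspace_diff)
  then have "orthogonal (u - q) (p - q)" "orthogonal (u - p) (p - q)"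
    using assms(3) q by auto
  then have "(p - q) \<bullet> (p - q) = 0"
    by (simp add: orthogonal_def inner_diff algebra_simps)
  then show "q = p" by simp
qed (use assms in auto)

lemma orth_proj_characterization:
  assumes "subspace T"
  shows orth_proj_in: "orth_proj T u \<in> T"
    and orth_proj_orthogonal: "t \<in> T \<Longrightarrow> orthogonal (u - orth_proj T u) t"
proof -
  have T: "span T = T"
    using assms by (simp add: span_eq_iff)
  obtain y z where yz: "y \<in> T" "\<And>w. w \<in> T \<Longrightarrow> orthogonal z w" "u = y + z"
    using orthogonal_subspace_decomp_exists[of T u] unfolding T by blast
  have "orth_proj T u = y"
    using yz by (intro orth_proj_eqI[OF assms]) auto
  then show "orth_proj T u \<in> T" "t \<in> T \<Longrightarrow> orthogonal (u - orth_proj T u) t"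
    using yz by auto
qed

lemma orth_proj_scale_add:
  assumes "subspace T" "d \<in> T"
  shows "orth_proj T (c *\<^sub>R u + d) = c *\<^sub>R orth_proj T u + d"
proof (rule orth_proj_eqI[OF assms(1)])
  show "c *\<^sub>R orth_proj T u + d \<in> T"
    using assms orth_proj_in[OF assms(1)] by (simp add: subspace_add subspace_scale)
  fix t assume "t \<in> T"
  then have "orthogonal (c *\<^sub>R (u - orth_proj T u)) t"
    using orth_proj_orthogonal[OF assms(1)] by (simp add: orthogonal_clauses)
  then show "orthogonal (c *\<^sub>R u + d - (c *\<^sub>R orth_proj T u + d)) t"
    by (simp add: scaleR_diff_right)
qed

section \<open>The second singular value of a doubly stochastic matrix\<close>

lemma poly_det: "poly (det B) t = det (\<chi> i j. poly (B $ i $ j) t)"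
  by (simp add: det_def poly_sum poly_prod)

lemma poly_char_poly: "poly (char_poly A) t = det (mat t - A)"
  unfolding char_poly_def poly_det
  by (rule arg_cong[where f = det]) (simp add: vec_eq_iff mat_def)

lemma mat_minus_vector_mult:
  fixes A :: "real ^ 'n ^ 'n"
  shows "(mat t - A) *v v = t *\<^sub>R v - A *v v"
proof -
  have "mat t *v v = t *\<^sub>R v"
    by (simp add: vec_eq_iff matrix_vector_mult_def mat_def if_distrib[of "\<lambda>x. x * _"] cong: if_cong)
  then show ?thesis
    by (simp add: matrix_vector_mult_diff_rdistrib)
qed

lemma char_poly_root_if_eigenvector:
  fixes A :: "real ^ 'n ^ 'n"
  assumes "A *v v = c *\<^sub>R v" "v \<noteq> 0"
  shows "poly (char_poly A) c = 0"
proof -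
  have "(mat c - A) *v v = 0"
    using assms(1) by (simp add: mat_minus_vector_mult)
  then have "\<not> invertible (mat c - A)"
    using assms(2) by (metis matrix_left_invertible_ker invertible_left_inverse)
  then show ?thesis
    by (simp add: poly_char_poly invertible_det_nz)
qed

lemma det_column_scale:
  fixes a :: "'n::finite \<Rightarrow> 'a::comm_ring_1"
  shows "det (\<chi> i j. if j = k then c * a i else B $ i $ j)
    = c * det (\<chi> i j. if j = k then a i else B $ i $ j)"
proof -
  have transp: "det (\<chi> i j. if j = k then b i else B $ i $ j)
      = det (\<chi> i. if i = k then (\<chi> j. b j) else (\<chi> j. B $ j $ i))" for b
    by (subst det_transpose[symmetric], rule arg_cong[where f = det])
      (simp add: vec_eq_iff transpose_def)
  have "(\<chi> j. c * a j) = c *s (\<chi> j. a j)"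
    by (simp add: vec_eq_iff)
  then show ?thesis
    unfolding transp by (simp only: det_row_mul)
qed

text \<open>Replacing column \<open>k\<close> of \<open>t I - A\<close> by the image of an eigenvector \<open>u\<close> multiplies the
  determinant by \<open>u $ k\<close> (Cramer), and that image is \<open>t - c\<close> times \<open>u\<close>. Doing this in two columns
  pulls out the factor \<open>(t - c)\<^sup>2\<close>. The second eigenvector is first made to vanish at \<open>k\<close>,
  so that the replaced column \<open>k\<close> does not contribute to its image.\<close>

lemma char_poly_double_root_if_two_eigenvectors:
  fixes A :: "real ^ 'n ^ 'n"
  assumes "A *v u = c *\<^sub>R u" "A *v v = c *\<^sub>R v" "u \<noteq> 0" "\<And>a. v \<noteq> a *\<^sub>R u"
  shows "[:- c, 1:]\<^sup>2 dvd char_poly A"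
proof -
  obtain k where k: "u $ k \<noteq> 0"
    using assms(3) by (auto simp: vec_eq_iff)
  define v' where "v' = v - (v $ k / u $ k) *\<^sub>R u"
  have "v' \<noteq> 0"
    using assms(4) by (simp add: v'_def)
  then obtain l where l: "v' $ l \<noteq> 0"
    by (auto simp: vec_eq_iff)
  have v'k: "v' $ k = 0"
    using k by (simp add: v'_def)
  have Av': "A *v v' = c *\<^sub>R v'"
    by (simp add: v'_def matrix_vector_mult_diff_distrib matrix_vector_mult_scaleR assms(1,2) algebra_simps)
  have shift: "(mat t - A) *v w = (t - c) *\<^sub>R w" if "A *v w = c *\<^sub>R w" for w t
    using that by (simp add: mat_minus_vector_mult scaleR_diff_left)
  define q where "q = det (\<chi> i j. if j = l then [:v' $ i:] else if j = k then [:u $ i:]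
      else (if i = j then [:0, 1:] else 0) - [:A $ i $ j:])"
  have "u $ k * v' $ l * poly (char_poly A) t = (t - c)\<^sup>2 * poly q t" for t
  proof -
    define B where "B = mat t - A"
    define B1 where "B1 = (\<chi> i j. if j = k then u $ i else B $ i $ j)"
    define B2 where "B2 = (\<chi> i j. if j = l then v' $ i else B1 $ i $ j)"
    have "u $ k * det B = det (\<chi> i j. if j = k then (t - c) * u $ i else B $ i $ j)"
      using cramer_lemma[of k B u] shift[OF assms(1), of t, folded B_def] by (simp cong: if_cong)
    also have "\<dots> = (t - c) * det B1"
      unfolding B1_def by (rule det_column_scale)
    finally have 1: "u $ k * det B = (t - c) * det B1" .
    have "B1 *v v' = B *v v'"
      using v'k by (auto simp: vec_eq_iff B1_def matrix_vector_mult_def intro!: sum.cong)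
    then have "v' $ l * det B1 = det (\<chi> i j. if j = l then (t - c) * v' $ i else B1 $ i $ j)"
      using cramer_lemma[of l B1 v'] shift[OF Av', of t, folded B_def] by (simp cong: if_cong)
    also have "\<dots> = (t - c) * det B2"
      unfolding B2_def by (rule det_column_scale)
    finally have 2: "v' $ l * det B1 = (t - c) * det B2" .
    have "poly q t = det B2"
      unfolding q_def poly_det B2_def B1_def B_def
      by (rule arg_cong[where f = det]) (simp add: vec_eq_iff mat_def)
    moreover have "u $ k * v' $ l * det B = (t - c)\<^sup>2 * det B2"
      using 1 2 by (simp add: power2_eq_square) (metis mult.assoc mult.left_commute)
    ultimately show ?thesis
      by (simp add: poly_char_poly B_def)
  qed
  then have "poly (smult (u $ k * v' $ l) (char_poly A)) = poly ([:- c, 1:]\<^sup>2 * q)"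
    by (intro ext) (simp add: poly_power)
  then have "smult (u $ k * v' $ l) (char_poly A) = [:- c, 1:]\<^sup>2 * q"
    by (simp only: poly_eq_poly_eq_iff)
  then have "[:- c, 1:]\<^sup>2 dvd smult (u $ k * v' $ l) (char_poly A)"
    by simp
  then show ?thesis
    using k l by (simp add: dvd_smult_iff)
qed

lemma second_largest_ge:
  fixes a b :: "'a::linorder"
  assumes "{#a, b#} \<subseteq># A" "c \<le> a" "c \<le> b"
  shows "c \<le> rev (sorted_list_of_multiset A) ! 1"
proof -
  define xs where "xs = rev (sorted_list_of_multiset A)"
  have A: "mset xs = A" and sorted: "sorted_wrt (\<ge>) xs"
    by (simp_all add: xs_def sorted_wrt_rev)
  \<comment> \<open>the case rule distinguishes lists of length 0, 1 and at least 2\<close>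
  obtain x y zs where xs: "xs = x # y # zs"
  proof (cases xs rule: remdups_adj.cases)
    case 1
    then show ?thesis using assms(1) A by simp
  next
    case (2 x)
    then show ?thesis using size_mset_mono[OF assms(1)] A by auto
  qed auto
  have "c \<le> y"
  proof (rule ccontr)
    assume "\<not> c \<le> y"
    then have "\<forall>z \<in># add_mset y (mset zs). \<not> c \<le> z"
      using sorted by (auto simp: xs)
    then have "filter_mset ((\<le>) c) (add_mset y (mset zs)) = {#}"
      by (induction zs) (auto simp: filter_mset_eq_conv)
    then have "size (filter_mset ((\<le>) c) A) \<le> 1"
      using A xs by auto
    moreover have "filter_mset ((\<le>) c) {#a, b#} = {#a, b#}"
      using assms(2,3) by simp
    then have "size {#a, b#} \<le> size (filter_mset ((\<le>) c) A)"
      using size_mset_mono[OF multiset_filter_mono[OF assms(1), of "(\<le>) c"]] by simp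
    ultimately show False by simp
  qed
  then show ?thesis
    by (simp add: xs flip: xs_def)
qed

lemma doubly_stochastic_ones:
  fixes W :: "real ^ 'n ^ 'n"
  assumes "doubly_stochastic W"
  shows "W *v 1 = 1" "transpose W *v 1 = 1"
  using assms
  by (auto simp: vec_eq_iff matrix_vector_mult_def transpose_def doubly_stochastic_def)

text \<open>Schur's test: bound each term \<open>y\<^sub>i z\<^sub>j\<close> of \<open>y \<bullet> W z\<close> with \<open>y = W z\<close> by the mean of the
  squares; the row and column sums are one.\<close>

lemma doubly_stochastic_norm_le:
  fixes W :: "real ^ 'n ^ 'n"
  assumes "doubly_stochastic W"
  shows "norm (W *v z) \<le> norm z"
proof -
  have W: "0 \<le> W $ i $ j" "(\<Sum>j\<in>UNIV. W $ i $ j) = 1" "(\<Sum>i\<in>UNIV. W $ i $ j) = 1" for i j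
    using assms by (auto simp: doubly_stochastic_def)
  define y where "y = W *v z"
  have "2 * (norm y)\<^sup>2 = 2 * (y \<bullet> (W *v z))"
    by (simp add: y_def power2_norm_eq_inner)
  also have "\<dots> = (\<Sum>i\<in>UNIV. \<Sum>j\<in>UNIV. W $ i $ j * (2 * y $ i * z $ j))"
    by (simp add: inner_vec_def matrix_vector_mult_def sum_distrib_left mult_ac)
  also have "\<dots> \<le> (\<Sum>i\<in>UNIV. \<Sum>j\<in>UNIV. W $ i $ j * ((y $ i)\<^sup>2 + (z $ j)\<^sup>2))"
    by (intro sum_mono mult_left_mono sum_squares_bound W(1))
  also have "\<dots> = (\<Sum>i\<in>UNIV. (\<Sum>j\<in>UNIV. W $ i $ j) * (y $ i)\<^sup>2) + (\<Sum>j\<in>UNIV. (\<Sum>i\<in>UNIV. W $ i $ j) * (z $ j)\<^sup>2)"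
    unfolding distrib_left sum.distrib sum_distrib_right
    by (rule arg_cong2[where f = "(+)", OF refl]) (rule sum.swap)
  also have "\<dots> = (norm y)\<^sup>2 + (norm z)\<^sup>2"
    unfolding W(2,3) power2_norm_eq_inner by (simp add: inner_vec_def power2_eq_square)
  finally have "(norm y)\<^sup>2 \<le> (norm z)\<^sup>2"
    by simp
  then show ?thesis
    unfolding y_def by (simp add: power2_le_iff_abs_le)
qed

text \<open>A vector \<open>v\<close> of the hyperplane \<open>\<one>\<^sup>\<bottom>\<close> maximising \<open>\<parallel>W v\<parallel> / \<parallel>v\<parallel>\<close> is an eigenvector of
  \<open>W\<^sup>T W\<close>, which preserves that hyperplane: along every line in the hyperplane the first variation
  of \<open>\<parallel>W v\<parallel>\<^sup>2 - \<mu> \<parallel>v\<parallel>\<^sup>2\<close> vanishes at \<open>v\<close>.\<close>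

lemma doubly_stochastic_maximiser:
  fixes W :: "real ^ 'n ^ 'n"
  assumes "doubly_stochastic W" "2 \<le> CARD('n)"
  obtains v \<mu> where "v \<noteq> 0" "v \<bullet> 1 = 0" "(transpose W ** W) *v v = \<mu> *\<^sub>R v"
    "0 \<le> \<mu>" "\<mu> \<le> 1" "\<And>y. y \<bullet> 1 = 0 \<Longrightarrow> (norm (W *v y))\<^sup>2 \<le> \<mu> * (norm y)\<^sup>2"
proof -
  define K where "K = sphere 0 1 \<inter> {y :: real ^ 'n. y \<bullet> 1 = 0}"
  have "compact K"
    unfolding K_def
    by (intro compact_Int_closed compact_sphere closed_Collect_eq continuous_intros)
  moreover have "K \<noteq> {}"
  proof -
    obtain i j :: 'n where "i \<noteq> j"
      using assms(2) by (metis (full_types) card_2_iff' ex_card subset_UNIV)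
    define y :: "real ^ 'n" where "y = axis i 1 - axis j 1"
    have "y $ i \<noteq> 0"
      using \<open>i \<noteq> j\<close> by (simp add: y_def axis_def)
    then have "y \<noteq> 0" by auto
    moreover have "y \<bullet> 1 = 0"
      by (simp add: y_def inner_diff_left inner_axis')
    ultimately have "sgn y \<in> K"
      by (simp add: K_def norm_sgn sgn_div_norm)
    then show ?thesis by auto
  qed
  moreover have "continuous_on K (\<lambda>y. (norm (W *v y))\<^sup>2)"
    by (intro continuous_intros linear_continuous_on matrix_vector_mul_bounded_linear)
  ultimately obtain v where v: "v \<in> K" "\<And>y. y \<in> K \<Longrightarrow> (norm (W *v y))\<^sup>2 \<le> (norm (W *v v))\<^sup>2"
    using continuous_attains_sup by metis
  define \<mu> where "\<mu> = (norm (W *v v))\<^sup>2"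
  have v1: "norm v = 1" "v \<bullet> 1 = 0"
    using v(1) by (auto simp: K_def)
  have max: "(norm (W *v y))\<^sup>2 \<le> \<mu> * (norm y)\<^sup>2" if "y \<bullet> 1 = 0" for y
  proof (cases "y = 0")
    case False
    then have "sgn y \<in> K"
      using that by (simp add: K_def norm_sgn sgn_div_norm)
    then have "(norm (W *v sgn y))\<^sup>2 \<le> \<mu>"
      using v(2) by (simp add: \<mu>_def)
    then show ?thesis
      using False by (simp add: sgn_div_norm matrix_vector_mult_scaleR power_mult_distrib field_simps)
  qed simp
  define A where "A = transpose W ** W"
  have A: "x \<bullet> (A *v y) = (W *v x) \<bullet> (W *v y)" for x y
    by (simp add: A_def dot_lmul_matrix[symmetric] flip: matrix_vector_mul_assoc)
      (metis dot_lmul_matrix inner_commute transpose_transpose vector_transpose_matrix)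
  note ones = doubly_stochastic_ones[OF assms(1)]
  have "(A *v v) \<bullet> 1 = 0"
    using A[of 1 v] ones v1(2) by (metis dot_lmul_matrix inner_commute vector_transpose_matrix)
  then have w1: "(A *v v - \<mu> *\<^sub>R v) \<bullet> 1 = 0"
    using v1(2) by (simp add: inner_diff_left)
  define w where "w = A *v v - \<mu> *\<^sub>R v"
  define b where "b = (norm (W *v w))\<^sup>2 - \<mu> * (norm w)\<^sup>2"
  have quadratic: "2 * t * (w \<bullet> w) + t\<^sup>2 * b \<le> 0" for t
  proof -
    have "(v + t *\<^sub>R w) \<bullet> 1 = 0"
      using v1(2) w1 by (simp add: inner_add_left w_def)
    from max[OF this] have "(norm (W *v v + t *\<^sub>R (W *v w)))\<^sup>2 \<le> \<mu> * (norm (v + t *\<^sub>R w))\<^sup>2"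
      by (simp add: matrix_vector_right_distrib matrix_vector_mult_scaleR)
    moreover have "(norm (W *v v + t *\<^sub>R (W *v w)))\<^sup>2
        = \<mu> + 2 * t * (w \<bullet> (A *v v)) + t\<^sup>2 * (norm (W *v w))\<^sup>2"
      unfolding A \<mu>_def power2_norm_eq_inner
      by (simp add: inner_add inner_commute power2_eq_square algebra_simps)
    moreover have "(norm (v + t *\<^sub>R w))\<^sup>2 = 1 + 2 * t * (w \<bullet> v) + t\<^sup>2 * (norm w)\<^sup>2"
      using v1(1) unfolding power2_norm_eq_inner norm_eq_1
      by (simp add: inner_add inner_commute power2_eq_square algebra_simps)
    moreover have "w \<bullet> w = w \<bullet> (A *v v) - \<mu> * (w \<bullet> v)"
      by (subst (2) w_def) (simp add: inner_diff_right)
    ultimately have "\<mu> + 2 * t * (w \<bullet> w + \<mu> * (w \<bullet> v)) + t\<^sup>2 * (norm (W *v w))\<^sup>2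
        \<le> \<mu> * (1 + 2 * t * (w \<bullet> v) + t\<^sup>2 * (norm w)\<^sup>2)"
      by simp
    then show ?thesis
      by (simp add: b_def algebra_simps)
  qed
  have "w = 0"
  proof (rule ccontr)
    assume "w \<noteq> 0"
    then have pos: "0 < w \<bullet> w" by simp
    \<comment> \<open>a step small enough for the linear term to dominate\<close>
    define t where "t = (w \<bullet> w) / (1 + \<bar>b\<bar>)"
    have "0 < t" "t * \<bar>b\<bar> \<le> w \<bullet> w"
      using pos by (auto simp: t_def field_simps)
    moreover have "- (t * b) \<le> t * \<bar>b\<bar>"
      using mult_left_mono[of "- b" "\<bar>b\<bar>" t] \<open>0 < t\<close> by simp
    ultimately have "0 < 2 * (w \<bullet> w) + t * b"
      using pos by linarith
    then have "0 < t * (2 * (w \<bullet> w) + t * b)"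
      using \<open>0 < t\<close> by simp
    then show False
      using quadratic[of t] by (simp add: algebra_simps power2_eq_square)
  qed
  then have "A *v v = \<mu> *\<^sub>R v"
    by (simp add: w_def)
  moreover have "v \<noteq> 0"
    using v1(1) by auto
  moreover have "0 \<le> \<mu>" "\<mu> \<le> 1"
    using doubly_stochastic_norm_le[OF assms(1), of v] v1(1) by (simp_all add: \<mu>_def power_le_one)
  ultimately show ?thesis
    using that v1(2) max by (simp add: A_def)
qed

text \<open>Both \<open>1\<close>, with the all-ones eigenvector, and \<open>\<mu>\<close> from the previous lemma are eigenvalues of
  \<open>W\<^sup>T W\<close>, with two independent eigenvectors even if they coincide; so \<open>\<mu>\<close> is at most the second
  largest one.\<close>

lemma second_singular_value_bound:
  fixes W :: "real ^ 'n ^ 'n"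
  assumes "doubly_stochastic W" "2 \<le> CARD('n)" "(\<Sum>i\<in>UNIV. y $ i) = 0"
  shows "norm (W *v y) \<le> second_singular_value W * norm y"
proof -
  define A where "A = transpose W ** W"
  obtain v \<mu> where v: "v \<noteq> 0" "v \<bullet> 1 = 0" "A *v v = \<mu> *\<^sub>R v" and \<mu>: "0 \<le> \<mu>" "\<mu> \<le> 1"
    and max: "\<And>y. y \<bullet> 1 = 0 \<Longrightarrow> (norm (W *v y))\<^sup>2 \<le> \<mu> * (norm y)\<^sup>2"
    using doubly_stochastic_maximiser[OF assms(1,2)] unfolding A_def by metis
  have A1: "A *v 1 = 1 *\<^sub>R 1"
    using doubly_stochastic_ones[OF assms(1)] by (simp add: A_def flip: matrix_vector_mul_assoc)
  have dsT: "doubly_stochastic (transpose W)"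
    using assms(1) by (simp add: doubly_stochastic_def transpose_def)
  have contr: "norm (A *v z) \<le> norm z" for z
    using doubly_stochastic_norm_le[OF dsT, of "W *v z"] doubly_stochastic_norm_le[OF assms(1), of z]
    by (simp add: A_def flip: matrix_vector_mul_assoc)
  \<comment> \<open>since \<open>A\<close> does not increase norms, \<open>2\<close> is not an eigenvalue\<close>
  have "char_poly A \<noteq> 0"
  proof
    assume "char_poly A = 0"
    then have "det (mat 2 - A) = 0"
      using poly_char_poly[of A 2] by simp
    then obtain z where z: "(mat 2 - A) *v z = 0" "z \<noteq> 0"
      by (metis invertible_det_nz invertible_left_inverse matrix_left_invertible_ker)
    then have "A *v z = 2 *\<^sub>R z"
      by (simp add: mat_minus_vector_mult)
    then show False
      using contr[of z] z(2) by simp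
  qed
  have sub: "{#1, \<mu>#} \<subseteq># eigenvalues A"
  proof (cases "\<mu> = 1")
    case True
    have "v \<noteq> a *\<^sub>R 1" for a
    proof
      assume a: "v = a *\<^sub>R 1"
      then have "a * (1 \<bullet> (1 :: real ^ 'n)) = 0"
        using v(2) by simp
      then show False
        using v(1) a by simp
    qed
    then have "[:- 1, 1:]\<^sup>2 dvd char_poly A"
      using char_poly_double_root_if_two_eigenvectors[OF A1, of v] v(3) True by simp
    then have "2 \<le> order 1 (char_poly A)"
      using \<open>char_poly A \<noteq> 0\<close> by (simp add: order_divides)
    then show ?thesis
      using True \<open>char_poly A \<noteq> 0\<close> by (auto simp: subseteq_mset_def eigenvalues_def)
  next
    case False
    have "order 1 (char_poly A) \<noteq> 0" "order \<mu> (char_poly A) \<noteq> 0"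
      using char_poly_root_if_eigenvector[OF A1] char_poly_root_if_eigenvector[OF v(3,1)]
        \<open>char_poly A \<noteq> 0\<close> by (auto simp: order_root)
    then show ?thesis
      using False \<open>char_poly A \<noteq> 0\<close> by (auto simp: subseteq_mset_def eigenvalues_def Suc_le_eq)
  qed
  have "sqrt \<mu> \<le> second_singular_value W"
    unfolding second_singular_value_def singular_values_def
    using image_mset_subseteq_mono[OF sub, of sqrt] \<mu>
    by (intro second_largest_ge[of "sqrt 1" "sqrt \<mu>"]) (auto simp: A_def)
  have "(norm (W *v y))\<^sup>2 \<le> \<mu> * (norm y)\<^sup>2"
    using assms(3) by (intro max) (simp add: inner_vec_def)
  also have "\<dots> = (sqrt \<mu> * norm y)\<^sup>2"
    using \<mu> by (simp add: power_mult_distrib)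
  finally have "norm (W *v y) \<le> sqrt \<mu> * norm y"
    using \<mu> by (simp add: power2_le_iff_abs_le)
  also have "\<dots> \<le> second_singular_value W * norm y"
    by (rule mult_right_mono) (fact, simp)
  finally show ?thesis .
qed

section \<open>One step of the decentralized iteration\<close>

lemma power2_norm_vec: "(norm X)\<^sup>2 = (\<Sum>i\<in>UNIV. (norm (X $ i))\<^sup>2)"
  by (simp add: norm_vec_def L2_set_def sum_nonneg)

lemma sum_minus_agent_mean: "(\<Sum>i\<in>UNIV. X $ i - agent_mean X) = 0"
  for X :: "'a::euclidean_space ^ 'n"
  by (simp add: agent_mean_def sum_subtractf scaleR_right.sum sum_constant_scaleR)

lemma norm_minus_constant_decomposition:
  fixes X :: "'a::euclidean_space ^ 'n"
  shows "(norm (X - (\<chi> i. y)))\<^sup>2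
    = (norm (X - (\<chi> i. agent_mean X)))\<^sup>2 + real CARD('n) * (norm (agent_mean X - y))\<^sup>2"
proof -
  define m where "m = agent_mean X"
  have "(norm (X $ i - y))\<^sup>2 = (norm (X $ i - m))\<^sup>2 + 2 * ((X $ i - m) \<bullet> (m - y)) + (norm (m - y))\<^sup>2"
    for i
    unfolding power2_norm_eq_inner by (simp add: inner_diff inner_commute)
  then have "(norm (X - (\<chi> i. y)))\<^sup>2 = (norm (X - (\<chi> i. m)))\<^sup>2
      + 2 * ((\<Sum>i\<in>UNIV. X $ i - m) \<bullet> (m - y)) + real CARD('n) * (norm (m - y))\<^sup>2"
    by (simp add: power2_norm_vec sum.distrib sum_distrib_left inner_sum_left)
  then show ?thesis
    unfolding m_def sum_minus_agent_mean by simp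
qed

text \<open>The sum of the squared distances from the \<open>X $ i\<close> to \<open>y\<close> exceeds its value at the mean
  by a multiple of the squared distance from \<open>y\<close> to the mean. The projection of the mean is therefore
  the best common approximation of the \<open>X $ i\<close> by a point of \<open>M\<close>.\<close>

lemma projected_mean_optimal:
  fixes X :: "'a::euclidean_space ^ 'n"
  assumes "nearest_point_projection M P" "y \<in> M"
  shows "norm (X - (\<chi> i. P (agent_mean X))) \<le> norm (X - (\<chi> i. y))"
proof -
  have "norm (agent_mean X - P (agent_mean X)) \<le> norm (agent_mean X - y)"
    using nearest_point_projection_le[OF assms, of "agent_mean X"]
    by (simp only: norm_minus_commute[of "agent_mean X"])
  then have "(norm (X - (\<chi> i. P (agent_mean X))))\<^sup>2 \<le> (norm (X - (\<chi> i. y)))\<^sup>2"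
    unfolding norm_minus_constant_decomposition[of X y]
      norm_minus_constant_decomposition[of X "P (agent_mean X)"]
    by (intro add_left_mono mult_left_mono power_mono) auto
  then show ?thesis
    by (rule power2_le_imp_le) simp
qed

text \<open>Apply the scalar bound to the coordinates in an orthonormal basis.\<close>

lemma weighted_average_contraction:
  fixes W :: "real ^ 'n ^ 'n" and Y :: "'a::euclidean_space ^ 'n"
  assumes "doubly_stochastic W" "2 \<le> CARD('n)" "0 \<le> second_singular_value W"
    and "(\<Sum>i\<in>UNIV. Y $ i) = 0"
  shows "norm (\<chi> i. \<Sum>j\<in>UNIV. W $ i $ j *\<^sub>R Y $ j) \<le> second_singular_value W * norm Y"
proof -
  have coordinates: "(norm Z)\<^sup>2 = (\<Sum>b\<in>Basis. (norm (\<chi> i. Z $ i \<bullet> b))\<^sup>2)" for Z :: "'a ^ 'n"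
  proof -
    have "(norm Z)\<^sup>2 = (\<Sum>i\<in>UNIV. \<Sum>b\<in>Basis. (Z $ i \<bullet> b)\<^sup>2)"
      unfolding power2_norm_vec power2_norm_eq_inner
      by (subst euclidean_inner) (simp add: power2_eq_square)
    also have "\<dots> = (\<Sum>b\<in>Basis. \<Sum>i\<in>UNIV. (Z $ i \<bullet> b)\<^sup>2)"
      by (rule sum.swap)
    finally show ?thesis
      by (simp add: power2_norm_vec)
  qed
  define Z where "Z = (\<chi> i. \<Sum>j\<in>UNIV. W $ i $ j *\<^sub>R Y $ j)"
  have bound: "(norm (\<chi> i. Z $ i \<bullet> b))\<^sup>2 \<le> (second_singular_value W)\<^sup>2 * (norm (\<chi> i. Y $ i \<bullet> b))\<^sup>2" for b
  proof -
    have "(\<chi> i. Z $ i \<bullet> b) = W *v (\<chi> i. Y $ i \<bullet> b)"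
      by (simp add: vec_eq_iff Z_def matrix_vector_mult_def inner_sum_left)
    moreover have "(\<Sum>i\<in>UNIV. Y $ i \<bullet> b) = 0"
      using assms(4) by (simp flip: inner_sum_left)
    ultimately have "norm (\<chi> i. Z $ i \<bullet> b) \<le> second_singular_value W * norm (\<chi> i. Y $ i \<bullet> b)"
      using second_singular_value_bound[OF assms(1,2)] by simp
    then show ?thesis
      by (simp add: power_mono flip: power_mult_distrib)
  qed
  have "(norm Z)\<^sup>2 = (\<Sum>b\<in>Basis. (norm (\<chi> i. Z $ i \<bullet> b))\<^sup>2)"
    by (rule coordinates)
  also have "\<dots> \<le> (\<Sum>b\<in>Basis. (second_singular_value W)\<^sup>2 * (norm (\<chi> i. Y $ i \<bullet> b))\<^sup>2)"
    by (intro sum_mono bound)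
  also have "\<dots> = (second_singular_value W * norm Y)\<^sup>2"
    by (simp add: coordinates[of Y] power_mult_distrib sum_distrib_left)
  finally have "(norm Z)\<^sup>2 \<le> (second_singular_value W * norm Y)\<^sup>2" .
  then have "norm Z \<le> second_singular_value W * norm Y"
    by (rule power2_le_imp_le) (simp add: assms(3))
  then show ?thesis
    by (simp only: Z_def)
qed

lemma mixing_matrix_card_ge_2:
  fixes W :: "real ^ 'n ^ 'n"
  assumes "mixing_matrix E W"
  shows "2 \<le> CARD('n)"
proof (rule ccontr)
  assume "\<not> 2 \<le> CARD('n)"
  moreover have "CARD('n) \<noteq> 0" by simp
  ultimately have "CARD('n) = 1" by linarith
  then obtain a :: 'n where a: "UNIV = {a}"
    by (rule card_1_singletonE)
  have "(\<Sum>j\<in>UNIV. W $ a $ j) = 1" "W $ a $ a < 1"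
    using assms by (auto simp: mixing_matrix_def doubly_stochastic_def)
  then show False
    unfolding a by simp
qed

text \<open>The quadratic retraction error of the perturbation is negligible: \<open>1 - \<rho>\<close> is at most
  \<open>\<gamma> (1 - s)\<close> with \<open>s = 8 M1 \<gamma> \<delta>\<close>, so \<open>M1 e\<close> is at most \<open>s (1 - s) / 32 \<le> 1 / 128\<close>. What remains
  is linear in \<open>e\<close> with a constant below \<open>4\<close>.\<close>

lemma consensus_error_budget:
  fixes R M1 \<gamma> \<sigma> \<delta> \<rho> e :: real
  assumes "0 < M1" "0 < \<gamma>" "\<gamma> \<le> 1" "0 \<le> \<sigma>" "0 \<le> \<delta>" "\<delta> < R"
    and \<rho>: "\<rho> = R * (1 - \<gamma> + \<gamma> * \<sigma>) / (R - \<delta>) + 8 * M1 * \<gamma>\<^sup>2 * \<delta>"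
    and e: "0 \<le> e" "e \<le> (1 - \<rho>) * \<delta> / 4"
  shows "R / (R - \<delta>) * ((1 - \<gamma> + \<gamma> * \<sigma>) * \<delta>) + 16 / 11 * e + M1 * (8 * \<gamma>\<^sup>2 * \<delta>\<^sup>2 + 2 * e\<^sup>2) \<le> \<delta>"
proof -
  define s where "s = 8 * M1 * \<gamma> * \<delta>"
  have "1 - \<gamma> \<le> 1 - \<gamma> + \<gamma> * \<sigma>"
    using assms by simp
  also have "\<dots> \<le> R * (1 - \<gamma> + \<gamma> * \<sigma>) / (R - \<delta>)"
    using assms by (simp add: pos_le_divide_eq mult_right_mono mult.commute)
  finally have "1 - \<rho> \<le> \<gamma> * (1 - s)"
    by (simp add: \<rho> s_def power2_eq_square algebra_simps)
  then have "(1 - \<rho>) * \<delta> \<le> \<gamma> * (1 - s) * \<delta>"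
    using assms(5) by (rule mult_right_mono)
  then have "M1 * e \<le> M1 * (\<gamma> * (1 - s) * \<delta> / 4)"
    using assms(1) e(2) by (intro mult_left_mono) auto
  also have "\<dots> = s * (1 - s) / 32"
    by (simp add: s_def)
  also have "\<dots> \<le> 1 / 128"
    using zero_le_power2[of "s - 1 / 2"] by (simp add: power2_eq_square algebra_simps)
  finally have "(M1 * e) * e \<le> 1 / 128 * e"
    using e(1) by (rule mult_right_mono)
  then have "2 * M1 * e\<^sup>2 \<le> e / 64"
    by (simp add: power2_eq_square algebra_simps)
  moreover have "R / (R - \<delta>) * (q * \<delta>) + M1 * (8 * \<gamma>\<^sup>2 * \<delta>\<^sup>2)
      = (R * q / (R - \<delta>) + 8 * M1 * \<gamma>\<^sup>2 * \<delta>) * \<delta>" for q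
    by (simp add: power2_eq_square distrib_right)
  then have "R / (R - \<delta>) * ((1 - \<gamma> + \<gamma> * \<sigma>) * \<delta>) + M1 * (8 * \<gamma>\<^sup>2 * \<delta>\<^sup>2) = \<rho> * \<delta>"
    by (simp only: \<rho>)
  moreover have "4 * e \<le> \<delta> - \<rho> * \<delta>"
    using e(2) by (simp add: algebra_simps)
  ultimately show ?thesis
    using e(1) unfolding distrib_left by linarith
qed

text \<open>Compare the new iterates with the old projected mean instead of the new one. The averaged
  points \<open>B $ i\<close> and the mean lie within \<open>\<delta>\<close> of \<open>M\<close>, where the projection has Lipschitz constant
  \<open>R / (R - \<delta>)\<close>. The perturbed points \<open>B $ i + D $ i\<close> may leave this neighbourhood but stay within
  \<open>5 / 16 R\<close> of \<open>M\<close>, which gives the constant \<open>16 / 11\<close> for the effect of the perturbation.\<close>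

lemma consensus_nbhd_step:
  fixes M :: "'a::euclidean_space set" and X X' D :: "'a ^ 'n" and W :: "real ^ 'n ^ 'n"
  assumes M: "compact M" "proximally_smooth R M" "nearest_point_projection M P"
    and tangent: "\<And>y. y \<in> M \<Longrightarrow> subspace (tangent_space M y)"
    and Rt: "retraction_on M Rt" "retraction_bound M P Rt M1"
    and W: "mixing_matrix E W"
    and \<gamma>: "0 < \<gamma>" "\<gamma> \<le> 1" and \<delta>: "0 \<le> \<delta>" "\<delta> < R / 4"
    and \<rho>: "\<rho> = R * (1 - \<gamma> + \<gamma> * second_singular_value W) / (R - \<delta>) + 8 * M1 * \<gamma>\<^sup>2 * \<delta>"
    and D: "\<And>i. D $ i \<in> tangent_space M (X $ i)" "norm D \<le> (1 - \<rho>) * \<delta> / 4"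
    and X: "X \<in> consensus_nbhd M P \<delta>"
    and X': "\<And>i. X' $ i = Rt (X $ i)
      (- \<gamma> *\<^sub>R orth_proj (tangent_space M (X $ i)) (X $ i - (\<Sum>j\<in>UNIV. W $ i $ j *\<^sub>R X $ j)) + D $ i)"
  shows "X' \<in> consensus_nbhd M P \<delta>"
proof -
  define \<sigma> where "\<sigma> = second_singular_value W"
  have ds: "doubly_stochastic W" and \<sigma>: "0 \<le> \<sigma>" "\<sigma> < 1"
    using W by (auto simp: mixing_matrix_def \<sigma>_def)
  then have Wnn: "0 \<le> W $ i $ j" and rows: "(\<Sum>j\<in>UNIV. W $ i $ j) = 1" for i j
    by (auto simp: doubly_stochastic_def)
  have "0 < M1"
    using Rt(2) by (simp add: retraction_bound_def)
  have XM: "X $ i \<in> M" for i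
    using X by (simp add: consensus_nbhd_def)
  define m where "m = agent_mean X"
  define p where "p = P m"
  have Xp: "norm (X - (\<chi> i. p)) \<le> \<delta>"
    using X by (simp add: consensus_nbhd_def m_def p_def)
  have pM: "p \<in> M"
    unfolding p_def by (rule nearest_point_projection_in[OF M(3)])
  define Y where "Y = X - (\<chi> i. m)"
  have split: "(norm Y)\<^sup>2 + real CARD('n) * (norm (m - p))\<^sup>2 \<le> \<delta>\<^sup>2"
    using norm_minus_constant_decomposition[of X p] power_mono[OF Xp, of 2]
    by (simp add: Y_def m_def)
  have "0 \<le> real CARD('n) * (norm (m - p))\<^sup>2" by simp
  then have "(norm Y)\<^sup>2 \<le> \<delta>\<^sup>2"
    using split by linarith
  then have Y\<delta>: "norm Y \<le> \<delta>"
    using \<delta>(1) by (rule power2_le_imp_le)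
  have "1 * (norm (m - p))\<^sup>2 \<le> real CARD('n) * (norm (m - p))\<^sup>2"
    by (rule mult_right_mono) (simp_all add: Suc_le_eq)
  then have "(norm (m - p))\<^sup>2 \<le> \<delta>\<^sup>2"
    using split zero_le_power2[of "norm Y"] by linarith
  then have mp: "norm (m - p) \<le> \<delta>"
    using \<delta>(1) by (rule power2_le_imp_le)
  define V where "V = (\<chi> i. \<Sum>j\<in>UNIV. W $ i $ j *\<^sub>R Y $ j)"
  have V: "norm V \<le> \<sigma> * norm Y"
    unfolding V_def \<sigma>_def
  proof (rule weighted_average_contraction[OF ds mixing_matrix_card_ge_2[OF W] \<sigma>(1)[unfolded \<sigma>_def]])
    show "(\<Sum>i\<in>UNIV. Y $ i) = 0"
      using sum_minus_agent_mean[of X] by (simp add: Y_def m_def)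
  qed
  have average: "(\<Sum>j\<in>UNIV. W $ i $ j *\<^sub>R (X $ j - y)) = (\<Sum>j\<in>UNIV. W $ i $ j *\<^sub>R X $ j) - y" for i y
    using rows[of i] by (simp add: scaleR_diff_right sum_subtractf flip: scaleR_left.sum)
  have Vi: "V $ i = (\<Sum>j\<in>UNIV. W $ i $ j *\<^sub>R X $ j) - m" for i
    using average[of i m] by (simp add: V_def Y_def)

  define B where "B = (\<chi> i. (1 - \<gamma>) *\<^sub>R X $ i + \<gamma> *\<^sub>R (\<Sum>j\<in>UNIV. W $ i $ j *\<^sub>R X $ j))"
  define U where "U = D - \<gamma> *\<^sub>R (Y - V)"
  have Bm: "B - (\<chi> i. m) = (1 - \<gamma>) *\<^sub>R Y + \<gamma> *\<^sub>R V"
    by (simp add: vec_eq_iff B_def Y_def Vi algebra_simps)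
  have XU: "X $ i + U $ i = B $ i + D $ i" for i
    by (simp add: B_def U_def Y_def Vi algebra_simps)

  have Bp: "norm (B $ i - p) \<le> \<delta>" for i
  proof -
    have comp: "norm (X $ j - p) \<le> \<delta>" for j
      using Finite_Cartesian_Product.norm_nth_le[of "X - (\<chi> i. p)" j] Xp by simp
    have "norm (\<Sum>j\<in>UNIV. W $ i $ j *\<^sub>R (X $ j - p)) \<le> (\<Sum>j\<in>UNIV. W $ i $ j * \<delta>)"
      by (rule sum_norm_le) (simp add: Wnn comp mult_left_mono)
    also have "\<dots> = \<delta>"
      using rows[of i] by (simp flip: sum_distrib_right)
    finally have 1: "norm (\<Sum>j\<in>UNIV. W $ i $ j *\<^sub>R (X $ j - p)) \<le> \<delta>" .
    have "B $ i - p = (1 - \<gamma>) *\<^sub>R (X $ i - p) + \<gamma> *\<^sub>R (\<Sum>j\<in>UNIV. W $ i $ j *\<^sub>R (X $ j - p))"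
      unfolding average by (simp add: B_def algebra_simps)
    also have "norm \<dots> \<le> (1 - \<gamma>) * \<delta> + \<gamma> * \<delta>"
      using \<gamma> comp[of i] 1 by (intro norm_triangle_le add_mono) (auto intro: mult_left_mono)
    finally show ?thesis
      by (simp add: algebra_simps)
  qed
  have tubeB: "norm (B $ i - P (B $ i)) \<le> \<delta>" for i
    using nearest_point_projection_le[OF M(3) pM, of "B $ i"] Bp[of i]
    by (simp add: norm_minus_commute)

  have "0 \<le> 1 - \<gamma> + \<gamma> * \<sigma>"
    using \<gamma> \<sigma>(1) by simp
  have "0 \<le> (1 - \<gamma> + \<gamma> * \<sigma>) * R / (R - \<delta>)"
    using \<delta> \<open>0 \<le> 1 - \<gamma> + \<gamma> * \<sigma>\<close> by (intro divide_nonneg_nonneg mult_nonneg_nonneg) auto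
  then have "0 \<le> \<rho>"
    using \<open>0 < M1\<close> \<delta>(1) by (simp add: \<rho> \<sigma>_def mult.commute)
  then have "(1 - \<rho>) * \<delta> \<le> 1 * \<delta>"
    using \<delta>(1) by (intro mult_right_mono) auto
  then have D\<delta>: "norm D \<le> \<delta> / 4"
    using D(2) by simp
  have tubeBD: "norm (B $ i + D $ i - P (B $ i + D $ i)) \<le> 5 / 16 * R" for i
  proof -
    have "norm (B $ i + D $ i - P (B $ i + D $ i)) \<le> norm ((B $ i - p) + D $ i)"
      using nearest_point_projection_le[OF M(3) pM, of "B $ i + D $ i"]
      by (simp add: norm_minus_commute algebra_simps)
    also have "\<dots> \<le> norm (B $ i - p) + norm (D $ i)"
      by (rule norm_triangle_ineq)
    also have "\<dots> \<le> \<delta> + \<delta> / 4"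
      using Bp[of i] D\<delta> Finite_Cartesian_Product.norm_nth_le[of D i] by linarith
    finally show ?thesis
      using \<delta> by linarith
  qed

  have "norm (B - (\<chi> i. m)) \<le> (1 - \<gamma>) * norm Y + \<gamma> * (\<sigma> * norm Y)"
    unfolding Bm using \<gamma> V
    by (intro norm_triangle_le add_mono) (auto intro: mult_left_mono)
  also have "\<dots> = (1 - \<gamma> + \<gamma> * \<sigma>) * norm Y"
    by (simp add: algebra_simps)
  also have "\<dots> \<le> (1 - \<gamma> + \<gamma> * \<sigma>) * \<delta>"
    using Y\<delta> \<open>0 \<le> 1 - \<gamma> + \<gamma> * \<sigma>\<close> by (rule mult_left_mono)
  finally have contraction: "norm (B - (\<chi> i. m)) \<le> (1 - \<gamma> + \<gamma> * \<sigma>) * \<delta>" .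
  have "norm ((\<chi> i. P (B $ i)) - (\<chi> i. p)) \<le> norm ((R / (R - \<delta>)) *\<^sub>R (B - (\<chi> i. m)))"
  proof (rule norm_le_componentwise_cart)
    fix i
    have "norm (P (B $ i) - P m) \<le> R / (R - \<delta>) * norm (B $ i - m)"
      using \<delta> mp tubeB by (intro projection_lipschitz[OF M]) (auto simp: p_def)
    then show "norm (((\<chi> i. P (B $ i)) - (\<chi> i. p)) $ i)
        \<le> norm (((R / (R - \<delta>)) *\<^sub>R (B - (\<chi> i. m))) $ i)"
      using \<delta> by (simp add: p_def)
  qed
  also have "\<dots> \<le> R / (R - \<delta>) * ((1 - \<gamma> + \<gamma> * \<sigma>) * \<delta>)"
    using \<delta> contraction by (simp add: divide_right_mono mult_left_mono)
  finally have term1: "norm ((\<chi> i. P (B $ i)) - (\<chi> i. p)) \<le> R / (R - \<delta>) * ((1 - \<gamma> + \<gamma> * \<sigma>) * \<delta>)" .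

  have term2: "norm ((\<chi> i. P (B $ i + D $ i)) - (\<chi> i. P (B $ i))) \<le> 16 / 11 * norm D"
  proof -
    have "norm ((\<chi> i. P (B $ i + D $ i)) - (\<chi> i. P (B $ i))) \<le> norm ((16 / 11 :: real) *\<^sub>R D)"
    proof (rule norm_le_componentwise_cart)
      fix i
      have "norm (B $ i - P (B $ i)) \<le> 5 / 16 * R"
        using tubeB[of i] \<delta> by linarith
      then have "norm (P (B $ i + D $ i) - P (B $ i)) \<le> R / (R - 5 / 16 * R) * norm (B $ i + D $ i - B $ i)"
        using tubeBD[of i] \<delta> by (intro projection_lipschitz[OF M]) auto
      also have "R / (R - 5 / 16 * R) = 16 / 11"
        using \<delta> by (simp add: field_simps)
      finally show "norm (((\<chi> i. P (B $ i + D $ i)) - (\<chi> i. P (B $ i))) $ i)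
          \<le> norm (((16 / 11 :: real) *\<^sub>R D) $ i)"
        by simp
    qed
    then show ?thesis by simp
  qed

  \<comment> \<open>the form of the step to which the defining property of \<open>M1\<close> applies\<close>
  have retract: "X' $ i = Rt (X $ i) (orth_proj (tangent_space M (X $ i)) (U $ i))" for i
  proof -
    have "U $ i = (- \<gamma>) *\<^sub>R (X $ i - (\<Sum>j\<in>UNIV. W $ i $ j *\<^sub>R X $ j)) + D $ i"
      by (simp add: U_def Y_def Vi algebra_simps)
    then show ?thesis
      unfolding X' using orth_proj_scale_add[OF tangent[OF XM] D(1)] by metis
  qed
  have "norm (X' - (\<chi> i. P (B $ i + D $ i))) \<le> M1 * (norm U)\<^sup>2"
  proof -
    have "norm (X' - (\<chi> i. P (B $ i + D $ i))) \<le> (\<Sum>i\<in>UNIV. norm (X' $ i - P (B $ i + D $ i)))"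
      unfolding norm_vec_def[of "X' - _"] by (rule order_trans[OF L2_set_le_sum]) auto
    also have "\<dots> \<le> (\<Sum>i\<in>UNIV. M1 * (norm (U $ i))\<^sup>2)"
    proof (rule sum_mono)
      fix i
      show "norm (X' $ i - P (B $ i + D $ i)) \<le> M1 * (norm (U $ i))\<^sup>2"
        using Rt(2) XM[of i] unfolding retraction_bound_def retract XU[symmetric]
        by (simp add: norm_minus_commute)
    qed
    finally show ?thesis
      by (simp add: power2_norm_vec sum_distrib_left)
  qed
  also have "\<dots> \<le> M1 * (8 * \<gamma>\<^sup>2 * \<delta>\<^sup>2 + 2 * (norm D)\<^sup>2)"
  proof -
    have "\<sigma> * norm Y \<le> 1 * norm Y"
      using \<sigma>(2) by (intro mult_right_mono) auto
    then have "norm (Y - V) \<le> 2 * \<delta>"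
      using norm_triangle_ineq4[of Y V] V Y\<delta> by linarith
    then have "\<gamma> * norm (Y - V) \<le> \<gamma> * (2 * \<delta>)"
      using \<gamma>(1) by (intro mult_left_mono) auto
    moreover have "norm U \<le> norm D + \<gamma> * norm (Y - V)"
      unfolding U_def using norm_triangle_ineq4[of D "\<gamma> *\<^sub>R (Y - V)"] \<gamma>(1) by simp
    ultimately have "norm U \<le> norm D + 2 * \<gamma> * \<delta>"
      by linarith
    then have "(norm U)\<^sup>2 \<le> (norm D + 2 * \<gamma> * \<delta>)\<^sup>2"
      by (rule power_mono) simp
    also have "\<dots> \<le> 8 * \<gamma>\<^sup>2 * \<delta>\<^sup>2 + 2 * (norm D)\<^sup>2"
      using sum_squares_bound[of "norm D" "2 * \<gamma> * \<delta>"]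
      by (simp add: power2_sum power_mult_distrib mult_ac)
    finally show ?thesis
      using \<open>0 < M1\<close> by (intro mult_left_mono) auto
  qed
  finally have term3: "norm (X' - (\<chi> i. P (B $ i + D $ i))) \<le> M1 * (8 * \<gamma>\<^sup>2 * \<delta>\<^sup>2 + 2 * (norm D)\<^sup>2)" .

  have X'M: "X' $ i \<in> M" for i
  proof -
    have "- \<gamma> *\<^sub>R orth_proj (tangent_space M (X $ i)) (X $ i - (\<Sum>j\<in>UNIV. W $ i $ j *\<^sub>R X $ j)) + D $ i
        \<in> tangent_space M (X $ i)"
      using tangent[OF XM] D(1) orth_proj_in[OF tangent[OF XM]]
      by (simp add: subspace_diff subspace_scale)
    then show ?thesis
      unfolding X' using Rt(1) XM[of i]
      unfolding retraction_on_def tangent_bundle_def by blast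
  qed
  have "norm (X' - (\<chi> i. P (agent_mean X'))) \<le> norm (X' - (\<chi> i. p))"
    by (rule projected_mean_optimal[OF M(3) pM])
  also have "X' - (\<chi> i. p) = ((\<chi> i. P (B $ i)) - (\<chi> i. p))
      + (((\<chi> i. P (B $ i + D $ i)) - (\<chi> i. P (B $ i))) + (X' - (\<chi> i. P (B $ i + D $ i))))"
    by simp
  also have "norm \<dots> \<le> R / (R - \<delta>) * ((1 - \<gamma> + \<gamma> * \<sigma>) * \<delta>)
      + (16 / 11 * norm D + M1 * (8 * \<gamma>\<^sup>2 * \<delta>\<^sup>2 + 2 * (norm D)\<^sup>2))"
    by (intro norm_triangle_le add_mono term1 term2 term3)
  also have "\<dots> \<le> \<delta>"
    using consensus_error_budget[OF \<open>0 < M1\<close> \<gamma> \<sigma>(1) \<delta>(1) _ \<rho>[folded \<sigma>_def] norm_ge_zero D(2)] \<delta>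
    by (simp add: add.assoc)
  finally show ?thesis
    using X'M by (simp add: consensus_nbhd_def)
qed

theorem lemma3p5:
  fixes M :: "(real ^ 'r ^ 'd) set"
    and m :: nat
    and R M1 \<gamma> \<eta> \<sigma>2 \<rho>2 \<delta> :: real
    and P :: "real ^ 'r ^ 'd \<Rightarrow> real ^ 'r ^ 'd"
    and Rt :: "real ^ 'r ^ 'd \<Rightarrow> real ^ 'r ^ 'd \<Rightarrow> real ^ 'r ^ 'd"
    and E :: "('n::finite \<times> 'n) set"
    and W :: "real ^ 'n ^ 'n"
    and x d :: "nat \<Rightarrow> (real ^ 'r ^ 'd) ^ 'n"
  assumes "compact M" and "smooth_submanifold m M"
    and "0 < R" and "proximally_smooth R M"
    and "nearest_point_projection M P"
    and "retraction_on M Rt" and "retraction_bound M P Rt M1"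
    and "mixing_matrix E W" and "\<sigma>2 = second_singular_value W"
    and "0 < \<gamma>" and "\<gamma> \<le> 1" and "0 < \<eta>"
    and "\<And>i k. d k $ i \<in> tangent_space M (x k $ i)"
    and "\<And>i k. x (Suc k) $ i =
           Rt (x k $ i)
              (- \<gamma> *\<^sub>R orth_proj (tangent_space M (x k $ i))
                           (x k $ i - (\<Sum>j\<in>UNIV. W $ i $ j *\<^sub>R x k $ j))
               + \<eta> *\<^sub>R d k $ i)"
    and "\<delta> \<in> {0 ..< min ((8 * M1 * \<gamma>\<^sup>2 * R + 1
             - sqrt ((8 * M1 * \<gamma>\<^sup>2 * R - 1)\<^sup>2 + 32 * M1 * \<gamma>\<^sup>2 * R * (1 - \<gamma> + \<gamma> * \<sigma>2)))
             / (16 * M1 * \<gamma>\<^sup>2)) (R / 4)}"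
    and "x 0 \<in> consensus_nbhd M P \<delta>"
    and "\<rho>2 = R * (1 - \<gamma> + \<gamma> * \<sigma>2) / (R - \<delta>) + 8 * M1 * \<gamma>\<^sup>2 * \<delta>"
    and "\<rho>2 < 1"
    and "\<And>k. norm (\<eta> *\<^sub>R d k) \<le> min (1 / (M1 * \<gamma>\<^sup>2)) ((1 - \<rho>2) * \<delta> / 4)"
  shows "\<forall>k. x k \<in> consensus_nbhd M P \<delta>"
proof
  fix k
  have \<delta>: "0 \<le> \<delta>" "\<delta> < R / 4"
    using assms(15) by auto
  show "x k \<in> consensus_nbhd M P \<delta>"
  proof (induction k)
    case 0
    show ?case by (rule assms(16))
  next
    case (Suc k)
    then have "x k $ i \<in> M" for i
      by (simp add: consensus_nbhd_def)
    then have tangent: "(\<eta> *\<^sub>R d k) $ i \<in> tangent_space M (x k $ i)" for i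
      using subspace_tangent_space[OF assms(2)] assms(13) by (simp add: subspace_scale)
    show ?case
    proof (rule consensus_nbhd_step[OF assms(1,4,5) subspace_tangent_space[OF assms(2)] assms(6-8,10,11)
          \<delta> assms(17)[unfolded assms(9)] tangent _ Suc.IH])
      show "norm (\<eta> *\<^sub>R d k) \<le> (1 - \<rho>2) * \<delta> / 4"
        using assms(19)[of k] by simp
      show "x (Suc k) $ i = Rt (x k $ i)
          (- \<gamma> *\<^sub>R orth_proj (tangent_space M (x k $ i))
             (x k $ i - (\<Sum>j\<in>UNIV. W $ i $ j *\<^sub>R x k $ j)) + (\<eta> *\<^sub>R d k) $ i)" for i
        by (simp only: assms(14) vector_scaleR_component)
    qed
  qed
qed

end
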